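(* Let $A$ be a dg algebra with enough idempotents. The following data give a dg category $A-Dg$ which is equivalent to the dg category $Dg-A^{op}$ of right dg $A^{op}$-modules: - the objects of $A-Dg$ are the left dg $A$-modules; - the morphisms in $A-Dg$ are defined as in the graded category $A-GR$ of graded left $A$-modules; - for each pair $(M,N)$ of objects, the differential $d:\mathrm{HOM}_{A^{op}}(M,N)\rightarrow\mathrm{HOM}_{A^{op}}(M,N)$ on Hom spaces is defined by the rule $d(f):=d_N\circ f-(-1)^{|f|}f\circ d_M$ for homogeneous $f$.
   Context: $K$ is a fixed commutative ring with unit; everything is $K$-linear; $|x|$ denotes degree. A dg category is a $K$-linear category whose Hom's are dg $K$-modules (graded $K$-modules with a square-zero degree $+1$ differential) with composition of degree zero satisfying $d(g\circ f)=d(g)\circ f+(-1)^{|g|}g\circ d(f)$. A dg functor preserves degrees of morphisms and commutes with differentials; an equivalence of dg categories is a full, faithful and dense dg functor. A dg algebra with enough idempotents is a graded associative $K$-algebra $A$ (not necessarily unital) having a family $(e_i)_{i\in I}$ of nonzero orthogonal homogeneous idempotents of degree $0$ with $A=\bigoplus_i e_iA=\bigoplus_i Ae_i$, together with a degree $+1$ $K$-linear map $d:A\to A$ with $d\circ d=0$, $d(e_i)=0$ and $d(ab)=d(a)b+(-1)^{|a|}ad(b)$. $A^{op}$ has the same graded $K$-module and differential, with multiplication $a^o\cdot b^o=(-1)^{|a||b|}(ba)^o$. All modules are unitary ($MA=M$, resp. $AM=M$). A right (resp. left) dg $A$-module is a graded right (resp. left) $A$-module $M$ with a degree $+1$ $K$-linear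 map $d_M$, $d_M\circ d_M=0$, such that $d_M(xa)=d_M(x)a+(-1)^{|x|}xd(a)$ (resp. $d_M(ax)=d(a)x+(-1)^{|a|}ad_M(x)$). $Dg-A$ is the dg category of right dg $A$-modules: $\mathrm{HOM}^n_A(M,N)$ consists of the right $A$-linear maps homogeneous of degree $n$, and $d(f)=d_N\circ f-(-1)^{|f|}f\circ d_M$. For a graded left $A$-module $M$, the shift $M[1]$ has $M[1]^n=M^{n+1}$ and multiplication $a\cdot x=(-1)^{|a|}ax$ ($ax$ the product in $M$). $A-Gr$ is the category of graded left $A$-modules with degree-zero $A$-linear maps. $A-GR$ has the same objects and graded Hom $\mathrm{HOM}_{A^{op}}(M,N)$ with $n$-th component $\mathrm{Hom}_{A-Gr}(M,N[n])$, i.e. the $K$-linear maps $f:M\to N$ homogeneous of degree $n$ with $f(ax)=(-1)^{n|a|}af(x)$; composition is composition of maps. *)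

theory Defs
  imports "HOL-Algebra.Module" "HOL-Algebra.Generated_Groups"
begin

section \<open>Internal direct sums, linear and bilinear maps\<close>

text \<open>
  \<open>f\<close> is a family of components of \<open>x\<close> for the submodules \<open>S i\<close>, \<open>i \<in> I\<close>: it is finitely
  supported, it is zero outside \<open>I\<close> (a normalisation that makes \<open>f\<close> a unique total function), and
  it sums up to \<open>x\<close>.
\<close>
definition is_decomp ::
    "('k, 'a, 'z) module_scheme \<Rightarrow> 'i set \<Rightarrow> ('i \<Rightarrow> 'a set) \<Rightarrow> 'a \<Rightarrow> ('i \<Rightarrow> 'a) \<Rightarrow> bool" where
  "is_decomp M I S x f \<longleftrightarrow>
     (\<forall>i\<in>I. f i \<in> S i) \<and> (\<forall>i. i \<notin> I \<longrightarrow> f i = \<zero>\<^bsub>M\<^esub>) \<and> finite {i. f i \<noteq> \<zero>\<^bsub>M\<^esub>} \<and>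
     x = (\<Oplus>\<^bsub>M\<^esub>i\<in>{i. f i \<noteq> \<zero>\<^bsub>M\<^esub>}. f i)"

definition internal_direct_sum ::
    "('k, 'x) ring_scheme \<Rightarrow> ('k, 'a, 'z) module_scheme \<Rightarrow> 'i set \<Rightarrow> ('i \<Rightarrow> 'a set) \<Rightarrow> bool" where
  "internal_direct_sum K M I S \<longleftrightarrow>
     (\<forall>i\<in>I. submodule (S i) K M) \<and> (\<forall>x\<in>carrier M. \<exists>!f. is_decomp M I S x f)"

definition is_linear ::
    "('k, 'x) ring_scheme \<Rightarrow> ('k, 'a, 'y) module_scheme \<Rightarrow> ('k, 'b, 'z) module_scheme
     \<Rightarrow> ('a \<Rightarrow> 'b) \<Rightarrow> bool" where
  "is_linear K M N f \<longleftrightarrow>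
     f \<in> hom (add_monoid M) (add_monoid N) \<and>
     (\<forall>k\<in>carrier K. \<forall>x\<in>carrier M. f (k \<odot>\<^bsub>M\<^esub> x) = k \<odot>\<^bsub>N\<^esub> f x)"

definition is_bilinear ::
    "('k, 'x) ring_scheme \<Rightarrow> ('k, 'a, 'u) module_scheme \<Rightarrow> ('k, 'b, 'v) module_scheme
     \<Rightarrow> ('k, 'c, 'w) module_scheme \<Rightarrow> ('a \<Rightarrow> 'b \<Rightarrow> 'c) \<Rightarrow> bool" where
  "is_bilinear K L M N \<beta> \<longleftrightarrow>
     (\<forall>x\<in>carrier L. is_linear K M N (\<beta> x)) \<and>
     (\<forall>y\<in>carrier M. is_linear K L N (\<lambda>x. \<beta> x y))"

text \<open>The element \<open>(-1)\<^sup>n x\<close>.\<close>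
definition ksign :: "('a, 'z) ring_scheme \<Rightarrow> int \<Rightarrow> 'a \<Rightarrow> 'a" where
  "ksign M n x = (if even n then x else \<ominus>\<^bsub>M\<^esub> x)"

section \<open>Graded and dg modules over \<open>K\<close>\<close>

text \<open>
  The records extend \<^typ>\<open>('k, 'a) module\<close>, hence contain the fields \<open>mult\<close> and \<open>one\<close> of a ring.
  As in \<^locale>\<open>module\<close>, these are irrelevant for modules; \<open>mult\<close> is used for the product of a
  dg algebra, and \<open>one\<close> is never used.
\<close>
record ('k, 'a) gmodule = "('k, 'a) module" +
  grade :: "int \<Rightarrow> 'a set"

record ('k, 'a) dgmodule = "('k, 'a) gmodule" +
  dif :: "'a \<Rightarrow> 'a"

locale graded_module = module K M
  for K :: "('k, 'x) ring_scheme" and M :: "('k, 'a, 'z) gmodule_scheme" +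
  assumes grading: "internal_direct_sum K M UNIV (grade M)"

locale dg_module = graded_module K M
  for K :: "('k, 'x) ring_scheme" and M :: "('k, 'a, 'z) dgmodule_scheme" +
  assumes dif_linear: "is_linear K M M (dif M)"
    and dif_degree: "x \<in> grade M n \<Longrightarrow> dif M x \<in> grade M (n + 1)"
    and dif_dif: "x \<in> carrier M \<Longrightarrow> dif M (dif M x) = \<zero>\<^bsub>M\<^esub>"

text \<open>\<open>hcomp M x n\<close> is the homogeneous component of degree \<open>n\<close> of \<open>x\<close>.\<close>
definition hcomp :: "('k, 'a, 'z) gmodule_scheme \<Rightarrow> 'a \<Rightarrow> int \<Rightarrow> 'a" where
  "hcomp M x = (THE f. is_decomp M UNIV (grade M) x f)"

definition hsupp :: "('k, 'a, 'z) gmodule_scheme \<Rightarrow> 'a \<Rightarrow> int set" where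
  "hsupp M x = {n. hcomp M x n \<noteq> \<zero>\<^bsub>M\<^esub>}"

section \<open>dg algebras with enough idempotents\<close>

locale dg_algebra_enough_idempotents = dg_module K A
  for K :: "('k, 'x) ring_scheme" and A :: "('k, 'a) dgmodule"
    and I :: "'i set" and e :: "'i \<Rightarrow> 'a" +
  assumes mult_bilinear: "is_bilinear K A A A (\<lambda>a b. a \<otimes>\<^bsub>A\<^esub> b)"
    and mult_assoc: "\<lbrakk>a \<in> carrier A; b \<in> carrier A; c \<in> carrier A\<rbrakk>
        \<Longrightarrow> (a \<otimes>\<^bsub>A\<^esub> b) \<otimes>\<^bsub>A\<^esub> c = a \<otimes>\<^bsub>A\<^esub> (b \<otimes>\<^bsub>A\<^esub> c)"
    and mult_degree: "\<lbrakk>a \<in> grade A m; b \<in> grade A n\<rbrakk> \<Longrightarrow> a \<otimes>\<^bsub>A\<^esub> b \<in> grade A (m + n)"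
    and leibniz: "\<lbrakk>a \<in> grade A m; b \<in> carrier A\<rbrakk>
        \<Longrightarrow> dif A (a \<otimes>\<^bsub>A\<^esub> b) = (dif A a \<otimes>\<^bsub>A\<^esub> b) \<oplus>\<^bsub>A\<^esub> ksign A m (a \<otimes>\<^bsub>A\<^esub> dif A b)"
    and idem_degree: "i \<in> I \<Longrightarrow> e i \<in> grade A 0"
    and idem_nonzero: "i \<in> I \<Longrightarrow> e i \<noteq> \<zero>\<^bsub>A\<^esub>"
    and idem: "i \<in> I \<Longrightarrow> e i \<otimes>\<^bsub>A\<^esub> e i = e i"
    and idem_orthogonal: "\<lbrakk>i \<in> I; j \<in> I; i \<noteq> j\<rbrakk> \<Longrightarrow> e i \<otimes>\<^bsub>A\<^esub> e j = \<zero>\<^bsub>A\<^esub>"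
    and idem_dif: "i \<in> I \<Longrightarrow> dif A (e i) = \<zero>\<^bsub>A\<^esub>"
    and right_decomp: "internal_direct_sum K A I (\<lambda>i. (\<lambda>a. e i \<otimes>\<^bsub>A\<^esub> a) ` carrier A)"
    and left_decomp: "internal_direct_sum K A I (\<lambda>i. (\<lambda>a. a \<otimes>\<^bsub>A\<^esub> e i) ` carrier A)"

text \<open>
  The opposite algebra: the bilinear extension of \<open>a\<^sup>o b\<^sup>o = (-1)\<^bsup>|a||b|\<^esup> (b a)\<^sup>o\<close> from
  homogeneous to arbitrary elements.
\<close>
definition dg_op :: "('k, 'a) dgmodule \<Rightarrow> ('k, 'a) dgmodule" where
  "dg_op A = A\<lparr>mult := \<lambda>a b. \<Oplus>\<^bsub>A\<^esub>p\<in>hsupp A a \<times> hsupp A b.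
     ksign A (fst p * snd p) (hcomp A b (snd p) \<otimes>\<^bsub>A\<^esub> hcomp A a (fst p))\<rparr>"

section \<open>Left and right modules over a dg algebra\<close>

record ('k, 'a, 'm) left_dgmodule = "('k, 'm) dgmodule" +
  lact :: "'a \<Rightarrow> 'm \<Rightarrow> 'm"

record ('k, 'a, 'm) right_dgmodule = "('k, 'm) dgmodule" +
  ract :: "'m \<Rightarrow> 'a \<Rightarrow> 'm"

locale graded_left_module = graded_module K M
  for K :: "('k, 'x) ring_scheme" and A :: "('k, 'a) dgmodule"
    and M :: "('k, 'a, 'm) left_dgmodule" +
  assumes lact_bilinear: "is_bilinear K A M M (lact M)"
    and lact_assoc: "\<lbrakk>a \<in> carrier A; b \<in> carrier A; x \<in> carrier M\<rbrakk>
        \<Longrightarrow> lact M (a \<otimes>\<^bsub>A\<^esub> b) x = lact M a (lact M b x)"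
    and lact_degree: "\<lbrakk>a \<in> grade A m; x \<in> grade M n\<rbrakk> \<Longrightarrow> lact M a x \<in> grade M (m + n)"
    and lact_unitary: "generate (add_monoid M) {lact M a x | a x. a \<in> carrier A \<and> x \<in> carrier M}
        = carrier M"

locale left_dg_module = graded_left_module K A M + dg_module K M
  for K :: "('k, 'x) ring_scheme" and A :: "('k, 'a) dgmodule"
    and M :: "('k, 'a, 'm) left_dgmodule" +
  assumes lact_leibniz: "\<lbrakk>a \<in> grade A n; x \<in> carrier M\<rbrakk>
        \<Longrightarrow> dif M (lact M a x) = lact M (dif A a) x \<oplus>\<^bsub>M\<^esub> ksign M n (lact M a (dif M x))"

locale graded_right_module = graded_module K M
  for K :: "('k, 'x) ring_scheme" and A :: "('k, 'a) dgmodule"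
    and M :: "('k, 'a, 'm) right_dgmodule" +
  assumes ract_bilinear: "is_bilinear K M A M (ract M)"
    and ract_assoc: "\<lbrakk>x \<in> carrier M; a \<in> carrier A; b \<in> carrier A\<rbrakk>
        \<Longrightarrow> ract M x (a \<otimes>\<^bsub>A\<^esub> b) = ract M (ract M x a) b"
    and ract_degree: "\<lbrakk>x \<in> grade M m; a \<in> grade A n\<rbrakk> \<Longrightarrow> ract M x a \<in> grade M (m + n)"
    and ract_unitary: "generate (add_monoid M) {ract M x a | x a. x \<in> carrier M \<and> a \<in> carrier A}
        = carrier M"

locale right_dg_module = graded_right_module K A M + dg_module K M
  for K :: "('k, 'x) ring_scheme" and A :: "('k, 'a) dgmodule"
    and M :: "('k, 'a, 'm) right_dgmodule" +
  assumes ract_leibniz: "\<lbrakk>x \<in> grade M n; a \<in> carrier A\<rbrakk>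
        \<Longrightarrow> dif M (ract M x a) = ract M (dif M x) a \<oplus>\<^bsub>M\<^esub> ksign M n (ract M x (dif A a))"

section \<open>dg categories, dg functors, equivalences\<close>

text \<open>\<open>cmp X Y Z g f\<close> is the composite \<open>g \<circ> f\<close> of \<open>f : X \<rightarrow> Y\<close> and \<open>g : Y \<rightarrow> Z\<close>.\<close>
record ('o, 'k, 'f) dgcat =
  obj :: "'o set"
  Hom :: "'o \<Rightarrow> 'o \<Rightarrow> ('k, 'f) dgmodule"
  cmp :: "'o \<Rightarrow> 'o \<Rightarrow> 'o \<Rightarrow> 'f \<Rightarrow> 'f \<Rightarrow> 'f"
  ident :: "'o \<Rightarrow> 'f"

locale dg_category =
  fixes K :: "('k, 'x) ring_scheme" and C :: "('o, 'k, 'f) dgcat"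
  assumes Hom_dg_module: "\<lbrakk>X \<in> obj C; Y \<in> obj C\<rbrakk> \<Longrightarrow> dg_module K (Hom C X Y)"
    and cmp_bilinear: "\<lbrakk>X \<in> obj C; Y \<in> obj C; Z \<in> obj C\<rbrakk>
        \<Longrightarrow> is_bilinear K (Hom C Y Z) (Hom C X Y) (Hom C X Z) (cmp C X Y Z)"
    and cmp_assoc: "\<lbrakk>W \<in> obj C; X \<in> obj C; Y \<in> obj C; Z \<in> obj C;
          f \<in> carrier (Hom C W X); g \<in> carrier (Hom C X Y); h \<in> carrier (Hom C Y Z)\<rbrakk>
        \<Longrightarrow> cmp C W X Z (cmp C X Y Z h g) f = cmp C W Y Z h (cmp C W X Y g f)"
    and ident_in: "X \<in> obj C \<Longrightarrow> ident C X \<in> carrier (Hom C X X)"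
    and ident_left: "\<lbrakk>X \<in> obj C; Y \<in> obj C; f \<in> carrier (Hom C X Y)\<rbrakk>
        \<Longrightarrow> cmp C X Y Y (ident C Y) f = f"
    and ident_right: "\<lbrakk>X \<in> obj C; Y \<in> obj C; f \<in> carrier (Hom C X Y)\<rbrakk>
        \<Longrightarrow> cmp C X X Y f (ident C X) = f"
    and cmp_degree: "\<lbrakk>X \<in> obj C; Y \<in> obj C; Z \<in> obj C;
          g \<in> grade (Hom C Y Z) m; f \<in> grade (Hom C X Y) n\<rbrakk>
        \<Longrightarrow> cmp C X Y Z g f \<in> grade (Hom C X Z) (m + n)"
    and cmp_leibniz: "\<lbrakk>X \<in> obj C; Y \<in> obj C; Z \<in> obj C;
          g \<in> grade (Hom C Y Z) m; f \<in> carrier (Hom C X Y)\<rbrakk>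
        \<Longrightarrow> dif (Hom C X Z) (cmp C X Y Z g f) =
            cmp C X Y Z (dif (Hom C Y Z) g) f
            \<oplus>\<^bsub>Hom C X Z\<^esub> ksign (Hom C X Z) m (cmp C X Y Z g (dif (Hom C X Y) f))"

locale dg_functor =
  fixes K :: "('k, 'x) ring_scheme" and C :: "('o, 'k, 'f) dgcat" and D :: "('p, 'k, 'g) dgcat"
    and Fo :: "'o \<Rightarrow> 'p" and Fm :: "'o \<Rightarrow> 'o \<Rightarrow> 'f \<Rightarrow> 'g"
  assumes Fo_obj: "X \<in> obj C \<Longrightarrow> Fo X \<in> obj D"
    and Fm_linear: "\<lbrakk>X \<in> obj C; Y \<in> obj C\<rbrakk>
        \<Longrightarrow> is_linear K (Hom C X Y) (Hom D (Fo X) (Fo Y)) (Fm X Y)"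
    and Fm_ident: "X \<in> obj C \<Longrightarrow> Fm X X (ident C X) = ident D (Fo X)"
    and Fm_cmp: "\<lbrakk>X \<in> obj C; Y \<in> obj C; Z \<in> obj C;
          g \<in> carrier (Hom C Y Z); f \<in> carrier (Hom C X Y)\<rbrakk>
        \<Longrightarrow> Fm X Z (cmp C X Y Z g f) = cmp D (Fo X) (Fo Y) (Fo Z) (Fm Y Z g) (Fm X Y f)"
    and Fm_degree: "\<lbrakk>X \<in> obj C; Y \<in> obj C; f \<in> grade (Hom C X Y) n\<rbrakk>
        \<Longrightarrow> Fm X Y f \<in> grade (Hom D (Fo X) (Fo Y)) n"
    and Fm_dif: "\<lbrakk>X \<in> obj C; Y \<in> obj C; f \<in> carrier (Hom C X Y)\<rbrakk>
        \<Longrightarrow> Fm X Y (dif (Hom C X Y) f) = dif (Hom D (Fo X) (Fo Y)) (Fm X Y f)"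

definition full_functor ::
    "('o, 'k, 'f) dgcat \<Rightarrow> ('p, 'k, 'g) dgcat \<Rightarrow> ('o \<Rightarrow> 'p) \<Rightarrow> ('o \<Rightarrow> 'o \<Rightarrow> 'f \<Rightarrow> 'g) \<Rightarrow> bool" where
  "full_functor C D Fo Fm \<longleftrightarrow>
     (\<forall>X\<in>obj C. \<forall>Y\<in>obj C. Fm X Y ` carrier (Hom C X Y) = carrier (Hom D (Fo X) (Fo Y)))"

definition faithful_functor ::
    "('o, 'k, 'f) dgcat \<Rightarrow> ('o \<Rightarrow> 'o \<Rightarrow> 'f \<Rightarrow> 'g) \<Rightarrow> bool" where
  "faithful_functor C Fm \<longleftrightarrow> (\<forall>X\<in>obj C. \<forall>Y\<in>obj C. inj_on (Fm X Y) (carrier (Hom C X Y)))"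

definition closed0 :: "('o, 'k, 'f) dgcat \<Rightarrow> 'o \<Rightarrow> 'o \<Rightarrow> 'f set" where
  "closed0 C X Y = {f \<in> grade (Hom C X Y) 0. dif (Hom C X Y) f = \<zero>\<^bsub>Hom C X Y\<^esub>}"

text \<open>
  Isomorphisms of objects of a dg category are taken in the category of closed morphisms of degree
  \<open>0\<close>; with arbitrary invertible morphisms a dg module would be isomorphic to its shifts.
\<close>
definition dg_isomorphic :: "('o, 'k, 'f) dgcat \<Rightarrow> 'o \<Rightarrow> 'o \<Rightarrow> bool" where
  "dg_isomorphic C X Y \<longleftrightarrow>
     (\<exists>f\<in>closed0 C X Y. \<exists>g\<in>closed0 C Y X. cmp C X Y X g f = ident C X \<and> cmp C Y X Y f g = ident C Y)"

definition dense_functor :: "('o, 'k, 'f) dgcat \<Rightarrow> ('p, 'k, 'g) dgcat \<Rightarrow> ('o \<Rightarrow> 'p) \<Rightarrow> bool" where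
  "dense_functor C D Fo \<longleftrightarrow> (\<forall>Y\<in>obj D. \<exists>X\<in>obj C. dg_isomorphic D (Fo X) Y)"

definition dg_equivalent ::
    "('k, 'x) ring_scheme \<Rightarrow> ('o, 'k, 'f) dgcat \<Rightarrow> ('p, 'k, 'g) dgcat \<Rightarrow> bool" where
  "dg_equivalent K C D \<longleftrightarrow> dg_category K C \<and> dg_category K D \<and>
     (\<exists>Fo Fm. dg_functor K C D Fo Fm \<and>
        full_functor C D Fo Fm \<and> faithful_functor C Fm \<and> dense_functor C D Fo)"

section \<open>The dg categories of left and of right dg modules\<close>

text \<open>
  Maps between modules are extensional functions (\<^const>\<open>undefined\<close> off the carrier of the domain),
  so that equality of morphisms is equality of functions.
\<close>
definition left_hom ::
    "('k, 'x) ring_scheme \<Rightarrow> ('k, 'a) dgmodule \<Rightarrow> ('k, 'a, 'm) left_dgmodule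
     \<Rightarrow> ('k, 'a, 'm) left_dgmodule \<Rightarrow> int \<Rightarrow> ('m \<Rightarrow> 'm) set" where
  "left_hom K A M N n =
     {f \<in> carrier M \<rightarrow>\<^sub>E carrier N. is_linear K M N f \<and>
        (\<forall>p. \<forall>x\<in>grade M p. f x \<in> grade N (p + n)) \<and>
        (\<forall>p. \<forall>a\<in>grade A p. \<forall>x\<in>carrier M. f (lact M a x) = ksign N (n * p) (lact N a (f x)))}"

definition right_hom ::
    "('k, 'x) ring_scheme \<Rightarrow> ('k, 'a) dgmodule \<Rightarrow> ('k, 'a, 'm) right_dgmodule
     \<Rightarrow> ('k, 'a, 'm) right_dgmodule \<Rightarrow> int \<Rightarrow> ('m \<Rightarrow> 'm) set" where
  "right_hom K A M N n =
     {f \<in> carrier M \<rightarrow>\<^sub>E carrier N. is_linear K M N f \<and>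
        (\<forall>p. \<forall>x\<in>grade M p. f x \<in> grade N (p + n)) \<and>
        (\<forall>x\<in>carrier M. \<forall>a\<in>carrier A. f (ract M x a) = ract N (f x) a)}"

text \<open>
  The graded \<open>K\<close>-module of maps \<open>M \<rightarrow> N\<close> with homogeneous components \<open>H n\<close> and pointwise operations:
  its elements are the finite sums of elements of the \<open>H n\<close>.
\<close>
definition graded_hom ::
    "('k, 'm, 'y) gmodule_scheme \<Rightarrow> ('k, 'm, 'z) gmodule_scheme \<Rightarrow> (int \<Rightarrow> ('m \<Rightarrow> 'm) set)
     \<Rightarrow> ('k, 'm \<Rightarrow> 'm) gmodule" where
  "graded_hom M N H =
     \<lparr>carrier = {(\<lambda>x\<in>carrier M. \<Oplus>\<^bsub>N\<^esub>n\<in>S. g n x) | S g. finite S \<and> (\<forall>n\<in>S. g n \<in> H n)},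
      mult = undefined,
      one = undefined,
      zero = (\<lambda>x\<in>carrier M. \<zero>\<^bsub>N\<^esub>),
      add = (\<lambda>f g. \<lambda>x\<in>carrier M. f x \<oplus>\<^bsub>N\<^esub> g x),
      smult = (\<lambda>k f. \<lambda>x\<in>carrier M. k \<odot>\<^bsub>N\<^esub> f x),
      grade = H\<rparr>"

text \<open>
  The differential is the linear extension to all of \<open>graded_hom M N H\<close> of the rule
  \<open>d(f) = d\<^sub>N \<circ> f - (-1)\<^bsup>|f|\<^esup> f \<circ> d\<^sub>M\<close> for homogeneous \<open>f\<close>.
\<close>
definition hom_dif ::
    "('k, 'm, 'y) dgmodule_scheme \<Rightarrow> ('k, 'm, 'z) dgmodule_scheme \<Rightarrow> (int \<Rightarrow> ('m \<Rightarrow> 'm) set)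
     \<Rightarrow> ('m \<Rightarrow> 'm) \<Rightarrow> 'm \<Rightarrow> 'm" where
  "hom_dif M N H f = (\<lambda>x\<in>carrier M. dif N (f x) \<ominus>\<^bsub>N\<^esub>
     (\<Oplus>\<^bsub>N\<^esub>n\<in>hsupp (graded_hom M N H) f. ksign N n (hcomp (graded_hom M N H) f n (dif M x))))"

definition dg_hom ::
    "('k, 'm, 'y) dgmodule_scheme \<Rightarrow> ('k, 'm, 'z) dgmodule_scheme \<Rightarrow> (int \<Rightarrow> ('m \<Rightarrow> 'm) set)
     \<Rightarrow> ('k, 'm \<Rightarrow> 'm) dgmodule" where
  "dg_hom M N H = gmodule.extend (graded_hom M N H) (dgmodule.fields (hom_dif M N H))"

text \<open>
  The category \<open>A-Dg\<close> of left dg \<open>A\<close>-modules and the category \<open>Dg-A\<close> of right dg \<open>A\<close>-modules whose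
  underlying sets are subsets of the (arbitrary) type \<open>'m\<close>.
\<close>
definition left_Dg ::
    "('k, 'x) ring_scheme \<Rightarrow> ('k, 'a) dgmodule
     \<Rightarrow> (('k, 'a, 'm) left_dgmodule, 'k, 'm \<Rightarrow> 'm) dgcat" where
  "left_Dg K A =
     \<lparr>obj = {M. left_dg_module K A M},
      Hom = (\<lambda>M N. dg_hom M N (left_hom K A M N)),
      cmp = (\<lambda>L M N g f. compose (carrier L) g f),
      ident = (\<lambda>M. \<lambda>x\<in>carrier M. x)\<rparr>"

definition right_Dg ::
    "('k, 'x) ring_scheme \<Rightarrow> ('k, 'a) dgmodule
     \<Rightarrow> (('k, 'a, 'm) right_dgmodule, 'k, 'm \<Rightarrow> 'm) dgcat" where
  "right_Dg K A =
     \<lparr>obj = {M. right_dg_module K A M},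
      Hom = (\<lambda>M N. dg_hom M N (right_hom K A M N)),
      cmp = (\<lambda>L M N g f. compose (carrier L) g f),
      ident = (\<lambda>M. \<lambda>x\<in>carrier M. x)\<rparr>"

end

theory Submission
  imports Defs
begin

text \<open>
  A left dg module \<open>M\<close> over \<open>A\<close> becomes a right dg module over the opposite algebra, on the same dg
  \<open>K\<close>-module, by \<open>x a\<^sup>o = (-1)\<^bsup>|x||a|\<^esup> a x\<close>, and every right dg module over the opposite algebra
  arises in this way.  The sign in the product of the opposite algebra makes associativity
  correspond to associativity, and the Leibniz rule and unitarity correspond as well
  (\<open>left_iff_right\<close>).

  Let \<open>f\<close> be a \<open>K\<close>-linear map of degree \<open>n\<close>.  Passing \<open>a\<close> across \<open>x\<close> costs \<open>(-1)\<^bsup>|x||a|\<^esup>\<close>, passing it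
  across \<open>f x\<close> costs \<open>(-1)\<^bsup>(|x| + n)|a|\<^esup>\<close>.  Hence \<open>f\<close> is linear for the right actions if and only if
  \<open>f (a x) = (-1)\<^bsup>n|a|\<^esup> a (f x)\<close>, that is, if and only if it is a morphism of degree \<open>n\<close> of graded left
  modules (\<open>left_hom_eq_right_hom\<close>).  The differential on morphisms is defined by the differentials
  of the modules alone, so the morphism complexes in the two categories are not only isomorphic but
  equal (\<open>dg_hom_mates\<close>).  The functor that changes the action and keeps the maps is therefore full
  and faithful, and it is dense since every right module comes from a left one.

  That left modules form a dg category has two parts.  For any family of graded maps closed under
  the linear operations and under \<open>f \<mapsto> d \<circ> f - (-1)\<^sup>n f \<circ> d\<close>, the finite sums of such maps form a dg
  module (\<open>hom_dg_module\<close>), and composition is bilinear and satisfies the Leibniz rule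
  (\<open>compose_bilinear\<close>, \<open>compose_leibniz\<close>).  The morphisms of left modules are such a family
  (\<open>left_hom_family\<close>).  Right modules inherit the structure from left modules through the equality
  of morphism complexes (\<open>dg_category_pullback\<close>).

  All signs depend on degrees, so actions, products and differentials on arbitrary elements are
  linear extensions from homogeneous ones.  Identities are proved by observing that both sides are
  linear in each argument and comparing them on homogeneous arguments (\<open>linear_eq_homogeneous\<close>).
\<close>

section \<open>Linear maps\<close>

lemma is_linearI:
  assumes "\<And>x. x \<in> carrier M \<Longrightarrow> f x \<in> carrier N"
    and "\<And>x y. \<lbrakk>x \<in> carrier M; y \<in> carrier M\<rbrakk> \<Longrightarrow> f (x \<oplus>\<^bsub>M\<^esub> y) = f x \<oplus>\<^bsub>N\<^esub> f y"
    and "\<And>k x. \<lbrakk>k \<in> carrier K; x \<in> carrier M\<rbrakk> \<Longrightarrow> f (k \<odot>\<^bsub>M\<^esub> x) = k \<odot>\<^bsub>N\<^esub> f x"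
  shows "is_linear K M N f"
  using assms by (auto simp: is_linear_def hom_def)

lemma linear_closed: "\<lbrakk>is_linear K M N f; x \<in> carrier M\<rbrakk> \<Longrightarrow> f x \<in> carrier N"
  by (auto simp: is_linear_def hom_def)

lemma linear_add:
  "\<lbrakk>is_linear K M N f; x \<in> carrier M; y \<in> carrier M\<rbrakk> \<Longrightarrow> f (x \<oplus>\<^bsub>M\<^esub> y) = f x \<oplus>\<^bsub>N\<^esub> f y"
  by (auto simp: is_linear_def hom_def)

lemma linear_smult:
  "\<lbrakk>is_linear K M N f; k \<in> carrier K; x \<in> carrier M\<rbrakk> \<Longrightarrow> f (k \<odot>\<^bsub>M\<^esub> x) = k \<odot>\<^bsub>N\<^esub> f x"
  by (auto simp: is_linear_def)

lemma linear_compose: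
  "\<lbrakk>is_linear K M N f; is_linear K L M g\<rbrakk> \<Longrightarrow> is_linear K L N (\<lambda>x. f (g x))"
  by (auto intro!: is_linearI simp: linear_closed[of K L M] linear_closed[of K M N]
      linear_add[of K L M] linear_add[of K M N] linear_smult[of K L M] linear_smult[of K M N])

lemma linear_cong:
  assumes "is_linear K M N f" "module K M" "\<And>x. x \<in> carrier M \<Longrightarrow> g x = f x"
  shows "is_linear K M N g"
proof -
  interpret module K M by fact
  show ?thesis using assms by (auto simp: is_linear_def hom_def)
qed

locale two_modules = M: module K M + N: module K N
  for K :: "('k, 'x) ring_scheme" and M :: "('k, 'a, 'y) module_scheme"
    and N :: "('k, 'b, 'z) module_scheme"
begin

lemma linear_zero: "is_linear K M N f \<Longrightarrow> f \<zero>\<^bsub>M\<^esub> = \<zero>\<^bsub>N\<^esub>"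
proof -
  assume f: "is_linear K M N f"
  have "f \<zero>\<^bsub>M\<^esub> \<oplus>\<^bsub>N\<^esub> f \<zero>\<^bsub>M\<^esub> = f \<zero>\<^bsub>M\<^esub>"
    using linear_add[OF f, of "\<zero>\<^bsub>M\<^esub>" "\<zero>\<^bsub>M\<^esub>"] by simp
  then show ?thesis using linear_closed[OF f, of "\<zero>\<^bsub>M\<^esub>"]
    by (metis M.zero_closed N.add.r_cancel_one')
qed

lemma linear_neg: "\<lbrakk>is_linear K M N f; x \<in> carrier M\<rbrakk> \<Longrightarrow> f (\<ominus>\<^bsub>M\<^esub> x) = \<ominus>\<^bsub>N\<^esub> f x"
proof -
  assume f: "is_linear K M N f" and x: "x \<in> carrier M"
  have "f (\<ominus>\<^bsub>M\<^esub> x) \<oplus>\<^bsub>N\<^esub> f x = \<zero>\<^bsub>N\<^esub>"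
    using linear_add[OF f, of "\<ominus>\<^bsub>M\<^esub> x" x] x by (simp add: M.l_neg linear_zero[OF f])
  then show ?thesis
    using x by (intro N.minus_equality[symmetric]) (auto simp: linear_closed[OF f])
qed

lemma linear_diff:
  "\<lbrakk>is_linear K M N f; x \<in> carrier M; y \<in> carrier M\<rbrakk> \<Longrightarrow> f (x \<ominus>\<^bsub>M\<^esub> y) = f x \<ominus>\<^bsub>N\<^esub> f y"
  by (simp add: M.minus_eq N.minus_eq linear_add[where M=M and N=N] linear_neg)

lemma linear_ksign:
  "\<lbrakk>is_linear K M N f; x \<in> carrier M\<rbrakk> \<Longrightarrow> f (ksign M n x) = ksign N n (f x)"
  by (simp add: ksign_def linear_neg)

lemma linear_finsum:
  assumes f: "is_linear K M N f" and "finite S" and "\<And>i. i \<in> S \<Longrightarrow> g i \<in> carrier M"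
  shows "f (\<Oplus>\<^bsub>M\<^esub>i\<in>S. g i) = (\<Oplus>\<^bsub>N\<^esub>i\<in>S. f (g i))"
  using assms(2,3)
proof (induction S)
  case empty
  then show ?case by (simp add: linear_zero[OF f])
next
  case (insert a S)
  have g: "g \<in> S \<rightarrow> carrier M" "g a \<in> carrier M" "(\<lambda>i. f (g i)) \<in> S \<rightarrow> carrier N"
    using insert.prems linear_closed[OF f] by auto
  then show ?case
    using insert by (simp add: linear_add[OF f] linear_closed[OF f])
qed

lemma is_linear_zero_map: "is_linear K M N (\<lambda>x. \<zero>\<^bsub>N\<^esub>)"
  by (rule is_linearI) auto

lemma is_linear_add:
  assumes "is_linear K M N f" "is_linear K M N g"
  shows "is_linear K M N (\<lambda>x. f x \<oplus>\<^bsub>N\<^esub> g x)"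
  by (rule is_linearI)
    (auto simp: linear_closed[OF assms(1)] linear_closed[OF assms(2)] linear_add[OF assms(1)]
      linear_add[OF assms(2)] linear_smult[OF assms(1)] linear_smult[OF assms(2)]
      N.smult_r_distr N.a_ac)

lemma is_linear_neg:
  assumes "is_linear K M N f"
  shows "is_linear K M N (\<lambda>x. \<ominus>\<^bsub>N\<^esub> f x)"
  by (rule is_linearI)
    (auto simp: linear_closed[OF assms] linear_add[OF assms] linear_smult[OF assms]
      N.smult_r_minus N.minus_add)

lemma is_linear_diff:
  "\<lbrakk>is_linear K M N f; is_linear K M N g\<rbrakk> \<Longrightarrow> is_linear K M N (\<lambda>x. f x \<ominus>\<^bsub>N\<^esub> g x)"
  unfolding a_minus_def by (intro is_linear_add is_linear_neg)

lemma is_linear_ksign: "is_linear K M N f \<Longrightarrow> is_linear K M N (\<lambda>x. ksign N n (f x))"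
  using is_linear_neg by (cases "even n") (auto simp: ksign_def)

lemma is_linear_finsum:
  assumes "finite S" "\<And>i. i \<in> S \<Longrightarrow> is_linear K M N (\<phi> i)"
  shows "is_linear K M N (\<lambda>x. \<Oplus>\<^bsub>N\<^esub>i\<in>S. \<phi> i x)"
  using assms
proof (induction S)
  case empty
  then show ?case by (simp add: is_linear_zero_map)
next
  case (insert a S)
  have "is_linear K M N (\<lambda>x. \<phi> a x \<oplus>\<^bsub>N\<^esub> (\<Oplus>\<^bsub>N\<^esub>i\<in>S. \<phi> i x))"
    using insert by (intro is_linear_add) auto
  then show ?case
  proof (rule linear_cong)
    show "(\<Oplus>\<^bsub>N\<^esub>i\<in>insert a S. \<phi> i x) = \<phi> a x \<oplus>\<^bsub>N\<^esub> (\<Oplus>\<^bsub>N\<^esub>i\<in>S. \<phi> i x)" if "x \<in> carrier M" for x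
      using insert that linear_closed[OF insert.prems] by (intro N.finsum_insert) auto
  qed (rule M.module_axioms)
qed

end

context module
begin

lemma is_linear_id: "is_linear R M M (\<lambda>x. x)"
  by (rule is_linearI) auto

lemma is_linear_smult: "k \<in> carrier R \<Longrightarrow> is_linear R M M (\<lambda>x. k \<odot>\<^bsub>M\<^esub> x)"
  by (rule is_linearI) (auto simp: smult_r_distr smult_assoc1[symmetric] R.m_comm)

lemma ksign_closed [simp]: "x \<in> carrier M \<Longrightarrow> ksign M n x \<in> carrier M"
  by (simp add: ksign_def)

lemma ksign_zero [simp]: "ksign M n \<zero>\<^bsub>M\<^esub> = \<zero>\<^bsub>M\<^esub>"
  by (simp add: ksign_def)

lemma ksign_add:
  "\<lbrakk>x \<in> carrier M; y \<in> carrier M\<rbrakk> \<Longrightarrow> ksign M n (x \<oplus>\<^bsub>M\<^esub> y) = ksign M n x \<oplus>\<^bsub>M\<^esub> ksign M n y"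
  by (simp add: ksign_def M.minus_add)

lemma ksign_ksign: "x \<in> carrier M \<Longrightarrow> ksign M m (ksign M n x) = ksign M (m + n) x"
  by (auto simp: ksign_def)

lemma minus_ksign: "x \<in> carrier M \<Longrightarrow> \<ominus>\<^bsub>M\<^esub> ksign M n x = ksign M (n + 1) x"
  by (auto simp: ksign_def)

lemma ksign_parity: "even m = even n \<Longrightarrow> ksign M m x = ksign M n x"
  by (simp add: ksign_def)

end

section \<open>Homogeneous components and linear extension\<close>

context graded_module
begin

lemma grade_submodule: "submodule (grade M n) K M"
  using grading by (auto simp: internal_direct_sum_def)


lemmas grade_ops = submoduleE[OF grade_submodule]

lemma grade_closed [intro]: "x \<in> grade M n \<Longrightarrow> x \<in> carrier M"
  using grade_ops(1) by auto

lemma grade_add: "\<lbrakk>x \<in> grade M n; y \<in> grade M n\<rbrakk> \<Longrightarrow> x \<oplus>\<^bsub>M\<^esub> y \<in> grade M n"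
  by (rule grade_ops(5))

lemma grade_neg: "x \<in> grade M n \<Longrightarrow> \<ominus>\<^bsub>M\<^esub> x \<in> grade M n"
  by (rule grade_ops(3))

lemma grade_smult: "\<lbrakk>k \<in> carrier K; x \<in> grade M n\<rbrakk> \<Longrightarrow> k \<odot>\<^bsub>M\<^esub> x \<in> grade M n"
  by (rule grade_ops(4))

lemma grade_zero: "\<zero>\<^bsub>M\<^esub> \<in> grade M n"
proof -
  obtain x where x: "x \<in> grade M n" using grade_ops(2) by auto
  have "\<ominus>\<^bsub>M\<^esub> x \<oplus>\<^bsub>M\<^esub> x \<in> grade M n" by (rule grade_add[OF grade_neg[OF x] x])
  then show ?thesis using x by (simp add: M.l_neg grade_closed)
qed

lemma grade_ksign: "x \<in> grade M n \<Longrightarrow> ksign M m x \<in> grade M n"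
  by (simp add: ksign_def grade_neg)

lemma grade_diff: "\<lbrakk>x \<in> grade M n; y \<in> grade M n\<rbrakk> \<Longrightarrow> x \<ominus>\<^bsub>M\<^esub> y \<in> grade M n"
  by (simp add: a_minus_def grade_add grade_neg)

lemma is_decompI:
  assumes "finite S" "\<And>n. f n \<in> grade M n" "\<And>n. n \<notin> S \<Longrightarrow> f n = \<zero>\<^bsub>M\<^esub>"
    and "x = (\<Oplus>\<^bsub>M\<^esub>n\<in>S. f n)"
  shows "is_decomp M UNIV (grade M) x f"
proof -
  have sub: "{n. f n \<noteq> \<zero>\<^bsub>M\<^esub>} \<subseteq> S" using assms(3) by auto
  have "(\<Oplus>\<^bsub>M\<^esub>n\<in>S. f n) = (\<Oplus>\<^bsub>M\<^esub>n\<in>{n. f n \<noteq> \<zero>\<^bsub>M\<^esub>}. f n)"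
    by (rule M.add.finprod_mono_neutral_cong_right) (use assms sub in auto)
  then show ?thesis
    using assms finite_subset[OF sub] by (auto simp: is_decomp_def)
qed

lemma decomp_hcomp: "x \<in> carrier M \<Longrightarrow> is_decomp M UNIV (grade M) x (hcomp M x)"
proof -
  assume "x \<in> carrier M"
  then have "\<exists>!f. is_decomp M UNIV (grade M) x f"
    using grading unfolding internal_direct_sum_def by blast
  then show ?thesis unfolding hcomp_def by (rule theI')
qed

lemma hcomp_eqI:
  assumes "is_decomp M UNIV (grade M) x f" "x \<in> carrier M"
  shows "hcomp M x = f"
proof -
  have "\<exists>!f. is_decomp M UNIV (grade M) x f"
    using grading assms(2) unfolding internal_direct_sum_def by blast
  then show ?thesis using decomp_hcomp[OF assms(2)] assms(1) by (elim ex1E) metis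
qed

lemma hcomp_grade: "x \<in> carrier M \<Longrightarrow> hcomp M x n \<in> grade M n"
  using decomp_hcomp by (auto simp: is_decomp_def)

lemma hcomp_closed [simp]: "x \<in> carrier M \<Longrightarrow> hcomp M x n \<in> carrier M"
  using hcomp_grade by auto

lemma finite_hsupp: "x \<in> carrier M \<Longrightarrow> finite (hsupp M x)"
  using decomp_hcomp by (auto simp: is_decomp_def hsupp_def)

lemma hcomp_sum: "x \<in> carrier M \<Longrightarrow> (\<Oplus>\<^bsub>M\<^esub>n\<in>hsupp M x. hcomp M x n) = x"
  using decomp_hcomp[of x] unfolding is_decomp_def hsupp_def by metis

lemma hcomp_sum_superset:
  assumes "x \<in> carrier M" "finite S" "hsupp M x \<subseteq> S"
  shows "(\<Oplus>\<^bsub>M\<^esub>n\<in>S. hcomp M x n) = x"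
proof -
  have "(\<Oplus>\<^bsub>M\<^esub>n\<in>hsupp M x. hcomp M x n) = (\<Oplus>\<^bsub>M\<^esub>n\<in>S. hcomp M x n)"
    by (rule M.add.finprod_mono_neutral_cong_left) (use assms in \<open>auto simp: hsupp_def\<close>)
  then show ?thesis using hcomp_sum[OF assms(1)] by simp
qed

lemma hcomp_homogeneous:
  assumes "x \<in> grade M n"
  shows "hcomp M x = (\<lambda>m. if m = n then x else \<zero>\<^bsub>M\<^esub>)"
proof (rule hcomp_eqI)
  show "is_decomp M UNIV (grade M) x (\<lambda>m. if m = n then x else \<zero>\<^bsub>M\<^esub>)"
    using assms grade_closed[OF assms] by (intro is_decompI[of "{n}"]) (auto simp: grade_zero)
qed (use assms in auto)

lemma hcomp_linear: "is_linear K M M (\<lambda>x. hcomp M x n)"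
proof (rule is_linearI)
  fix x y assume xy: "x \<in> carrier M" "y \<in> carrier M"
  let ?S = "hsupp M x \<union> hsupp M y"
  have fin: "finite ?S" using xy by (auto simp: finite_hsupp)
  have "x \<oplus>\<^bsub>M\<^esub> y = (\<Oplus>\<^bsub>M\<^esub>n\<in>?S. hcomp M x n) \<oplus>\<^bsub>M\<^esub> (\<Oplus>\<^bsub>M\<^esub>n\<in>?S. hcomp M y n)"
    using hcomp_sum_superset[of x ?S] hcomp_sum_superset[of y ?S] xy fin by auto
  also have "\<dots> = (\<Oplus>\<^bsub>M\<^esub>n\<in>?S. hcomp M x n \<oplus>\<^bsub>M\<^esub> hcomp M y n)"
    using xy by (intro M.finsum_addf[symmetric]) auto
  finally have "hcomp M (x \<oplus>\<^bsub>M\<^esub> y) = (\<lambda>n. hcomp M x n \<oplus>\<^bsub>M\<^esub> hcomp M y n)"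
    by (intro hcomp_eqI is_decompI[OF fin])
      (use xy in \<open>auto simp: hcomp_grade grade_add hsupp_def\<close>)
  then show "hcomp M (x \<oplus>\<^bsub>M\<^esub> y) n = hcomp M x n \<oplus>\<^bsub>M\<^esub> hcomp M y n" by simp
next
  fix k x assume kx: "k \<in> carrier K" "x \<in> carrier M"
  interpret MM: two_modules K M M by unfold_locales
  have "k \<odot>\<^bsub>M\<^esub> x = k \<odot>\<^bsub>M\<^esub> (\<Oplus>\<^bsub>M\<^esub>n\<in>hsupp M x. hcomp M x n)"
    using hcomp_sum[OF kx(2)] by simp
  also have "\<dots> = (\<Oplus>\<^bsub>M\<^esub>n\<in>hsupp M x. k \<odot>\<^bsub>M\<^esub> hcomp M x n)"
    using kx by (intro MM.linear_finsum[OF is_linear_smult]) (auto simp: finite_hsupp)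
  finally have "hcomp M (k \<odot>\<^bsub>M\<^esub> x) = (\<lambda>n. k \<odot>\<^bsub>M\<^esub> hcomp M x n)"
    by (intro hcomp_eqI is_decompI[OF finite_hsupp[OF kx(2)]])
      (use kx in \<open>auto simp: hcomp_grade grade_smult hsupp_def\<close>)
  then show "hcomp M (k \<odot>\<^bsub>M\<^esub> x) n = k \<odot>\<^bsub>M\<^esub> hcomp M x n" by simp
qed simp

text \<open>
  Every element is the finite sum of its homogeneous components, so a property that survives
  addition only has to be checked on homogeneous elements.  This is how each identity below that
  involves a Koszul sign, which makes sense only for homogeneous elements, is reduced to a
  computation with signs.
\<close>
lemma homogeneous_induct [consumes 1, case_names homogeneous zero add]:
  assumes "x \<in> carrier M"
    and "\<And>n x. x \<in> grade M n \<Longrightarrow> P x"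
    and "P \<zero>\<^bsub>M\<^esub>"
    and "\<And>x y. \<lbrakk>x \<in> carrier M; y \<in> carrier M; P x; P y\<rbrakk> \<Longrightarrow> P (x \<oplus>\<^bsub>M\<^esub> y)"
  shows "P x"
proof -
  have "finite S \<Longrightarrow> P (\<Oplus>\<^bsub>M\<^esub>n\<in>S. hcomp M x n)" for S
  proof (induction S rule: finite_induct)
    case empty
    then show ?case by (simp add: assms(3))
  next
    case (insert n S)
    have "P (hcomp M x n)" by (rule assms(2)[OF hcomp_grade[OF assms(1)]])
    then show ?case
      using insert assms(1) by (subst M.finsum_insert) (auto intro!: assms(4))
  qed
  from this[OF finite_hsupp[OF assms(1)]] show ?thesis
    by (simp add: hcomp_sum[OF assms(1)])
qed

lemma linear_eq_homogeneous:
  assumes f: "is_linear K M N f" and g: "is_linear K M N g" and "module K N"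
    and eq: "\<And>n x. x \<in> grade M n \<Longrightarrow> f x = g x" and x: "x \<in> carrier M"
  shows "f x = g x"
proof -
  interpret MN: two_modules K M N
    using assms by (simp add: two_modules_def module_axioms)
  show ?thesis using x
    by (induction x rule: homogeneous_induct)
      (auto simp: eq MN.linear_zero[OF f] MN.linear_zero[OF g] linear_add[OF f] linear_add[OF g])
qed

text \<open>
  Sums over the support of an element are not visibly additive, because the support of \<open>x \<oplus> y\<close> is
  not determined by those of \<open>x\<close> and \<open>y\<close>.  They become linear once the index set is fixed: any finite
  set containing the supports of all elements in question may be used instead, as the additional
  terms vanish.
\<close>
lemma linear_by_support:
  assumes "module K N"
    and lin: "\<And>S. finite S \<Longrightarrow> is_linear K M N (F S)"
    and eq: "\<And>S x. \<lbrakk>x \<in> carrier M; finite S; hsupp M x \<subseteq> S\<rbrakk> \<Longrightarrow> f x = F S x"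
  shows "is_linear K M N f"
proof (rule is_linearI)
  fix x assume x: "x \<in> carrier M"
  show "f x \<in> carrier N"
    using eq[OF x finite_hsupp[OF x]] linear_closed[OF lin x] finite_hsupp[OF x] by simp
next
  fix x y assume xy: "x \<in> carrier M" "y \<in> carrier M"
  define S where "S = hsupp M x \<union> hsupp M y \<union> hsupp M (x \<oplus>\<^bsub>M\<^esub> y)"
  have S: "finite S" "hsupp M x \<subseteq> S" "hsupp M y \<subseteq> S" "hsupp M (x \<oplus>\<^bsub>M\<^esub> y) \<subseteq> S"
    using xy by (auto simp: S_def finite_hsupp)
  then show "f (x \<oplus>\<^bsub>M\<^esub> y) = f x \<oplus>\<^bsub>N\<^esub> f y"
    using linear_add[OF lin[OF S(1)] xy] eq[of x S] eq[of y S] eq[of "x \<oplus>\<^bsub>M\<^esub> y" S] xy by simp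
next
  fix k x assume kx: "k \<in> carrier K" "x \<in> carrier M"
  define S where "S = hsupp M x \<union> hsupp M (k \<odot>\<^bsub>M\<^esub> x)"
  have S: "finite S" "hsupp M x \<subseteq> S" "hsupp M (k \<odot>\<^bsub>M\<^esub> x) \<subseteq> S"
    using kx by (auto simp: S_def finite_hsupp)
  then show "f (k \<odot>\<^bsub>M\<^esub> x) = k \<odot>\<^bsub>N\<^esub> f x"
    using linear_smult[OF lin[OF S(1)] kx] eq[of x S] eq[of "k \<odot>\<^bsub>M\<^esub> x" S] kx by simp
qed

end

text \<open>
  The linear extension of a rule \<open>\<phi> n\<close> that is prescribed on the homogeneous elements of degree \<open>n\<close>.
\<close>
definition hext ::
    "('k, 'a, 'y) gmodule_scheme \<Rightarrow> ('k, 'b, 'z) module_scheme \<Rightarrow> (int \<Rightarrow> 'a \<Rightarrow> 'b) \<Rightarrow> 'a \<Rightarrow> 'b"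
  where "hext M N \<phi> x = (\<Oplus>\<^bsub>N\<^esub>n\<in>hsupp M x. \<phi> n (hcomp M x n))"

locale hext_maps = graded_module K M + N: module K N
  for K :: "('k, 'x) ring_scheme" and M :: "('k, 'a, 'y) gmodule_scheme"
    and N :: "('k, 'b, 'z) module_scheme" +
  fixes \<phi> :: "int \<Rightarrow> 'a \<Rightarrow> 'b"
  assumes linear: "\<And>n. is_linear K M N (\<phi> n)"
begin

sublocale two_modules K M N
  by unfold_locales

lemma hext_superset:
  assumes "x \<in> carrier M" "finite S" "hsupp M x \<subseteq> S"
  shows "hext M N \<phi> x = (\<Oplus>\<^bsub>N\<^esub>n\<in>S. \<phi> n (hcomp M x n))"
  unfolding hext_def
  by (rule N.add.finprod_mono_neutral_cong_left)
    (use assms in \<open>auto simp: hsupp_def linear_zero[OF linear] linear_closed[OF linear]\<close>)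

lemma hext_linear: "is_linear K M N (hext M N \<phi>)"
proof (rule linear_by_support[OF N.module_axioms])
  fix S :: "int set" assume S: "finite S"
  show "is_linear K M N (\<lambda>x. \<Oplus>\<^bsub>N\<^esub>n\<in>S. \<phi> n (hcomp M x n))"
    by (intro is_linear_finsum S linear_compose[OF linear hcomp_linear])
qed (rule hext_superset)

lemma hext_homogeneous:
  assumes "x \<in> grade M n"
  shows "hext M N \<phi> x = \<phi> n x"
proof -
  have x: "x \<in> carrier M" using assms by auto
  have "hext M N \<phi> x = (\<Oplus>\<^bsub>N\<^esub>m\<in>{n}. \<phi> m (hcomp M x m))"
    using x by (intro hext_superset) (auto simp: hsupp_def hcomp_homogeneous[OF assms])
  then show ?thesis
    using x by (simp add: hcomp_homogeneous[OF assms] linear_closed[OF linear])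
qed

end

section \<open>Bilinear maps twisted by the Koszul sign\<close>

lemma is_bilinear_flip: "is_bilinear K L M N \<beta> \<Longrightarrow> is_bilinear K M L N (\<lambda>y x. \<beta> x y)"
  by (auto simp: is_bilinear_def)

lemma bilinear_left: "\<lbrakk>is_bilinear K L M N \<beta>; y \<in> carrier M\<rbrakk> \<Longrightarrow> is_linear K L N (\<lambda>x. \<beta> x y)"
  by (simp add: is_bilinear_def)

lemma bilinear_right: "\<lbrakk>is_bilinear K L M N \<beta>; x \<in> carrier L\<rbrakk> \<Longrightarrow> is_linear K M N (\<beta> x)"
  by (simp add: is_bilinear_def)

lemma bilinear_closed:
  "\<lbrakk>is_bilinear K L M N \<beta>; x \<in> carrier L; y \<in> carrier M\<rbrakk> \<Longrightarrow> \<beta> x y \<in> carrier N"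
  by (rule linear_closed[OF bilinear_right])

text \<open>
  The bilinear extension of \<open>(x, y) \<mapsto> (-1)\<^bsup>|x||y|\<^esup> \<beta>(x, y)\<close>.  The product of the opposite algebra has this
  form, and so does the passage between left and right actions; the argument order of the double sum
  matches the one in \<^const>\<open>dg_op\<close>.
\<close>
definition ktwist ::
    "('k, 'a, 'u) gmodule_scheme \<Rightarrow> ('k, 'b, 'v) gmodule_scheme \<Rightarrow> ('k, 'c, 'w) module_scheme
     \<Rightarrow> ('a \<Rightarrow> 'b \<Rightarrow> 'c) \<Rightarrow> 'a \<Rightarrow> 'b \<Rightarrow> 'c" where
  "ktwist L M N \<beta> x y = (\<Oplus>\<^bsub>N\<^esub>p\<in>hsupp L x \<times> hsupp M y.
     ksign N (fst p * snd p) (\<beta> (hcomp L x (fst p)) (hcomp M y (snd p))))"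

locale graded_pair = L: graded_module K L + M: graded_module K M + N: module K N
  for K :: "('k, 'x) ring_scheme" and L :: "('k, 'a, 'u) gmodule_scheme"
    and M :: "('k, 'b, 'v) gmodule_scheme" and N :: "('k, 'c, 'w) module_scheme"
begin

sublocale LN: two_modules K L N by unfold_locales
sublocale MN: two_modules K M N by unfold_locales

lemma bilinear_eq_homogeneous:
  assumes \<beta>: "is_bilinear K L M N \<beta>" and \<gamma>: "is_bilinear K L M N \<gamma>"
    and eq: "\<And>p q x y. \<lbrakk>x \<in> grade L p; y \<in> grade M q\<rbrakk> \<Longrightarrow> \<beta> x y = \<gamma> x y"
    and x: "x \<in> carrier L" and y: "y \<in> carrier M"
  shows "\<beta> x y = \<gamma> x y"
proof (rule L.linear_eq_homogeneous[OF bilinear_left[OF \<beta> y] bilinear_left[OF \<gamma> y] N.module_axioms _ x])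
  fix p x assume x: "x \<in> grade L p"
  show "\<beta> x y = \<gamma> x y"
    using bilinear_right[OF \<beta>] bilinear_right[OF \<gamma>] L.grade_closed[OF x]
    by (intro M.linear_eq_homogeneous[OF _ _ N.module_axioms eq[OF x] y])
qed

context
  fixes \<beta> :: "'a \<Rightarrow> 'b \<Rightarrow> 'c"
  assumes \<beta>: "is_bilinear K L M N \<beta>"
begin

private abbreviation tw where
  "tw x y p \<equiv> ksign N (fst p * snd p) (\<beta> (hcomp L x (fst p)) (hcomp M y (snd p)))"

lemma ktwist_superset:
  assumes "x \<in> carrier L" "finite P" "hsupp L x \<subseteq> P" "y \<in> carrier M" "finite Q" "hsupp M y \<subseteq> Q"
  shows "ktwist L M N \<beta> x y = (\<Oplus>\<^bsub>N\<^esub>p\<in>P \<times> Q. tw x y p)"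
  unfolding ktwist_def
proof (rule N.add.finprod_mono_neutral_cong_left)
  fix p assume "p \<in> P \<times> Q - hsupp L x \<times> hsupp M y"
  then have "hcomp L x (fst p) = \<zero>\<^bsub>L\<^esub> \<or> hcomp M y (snd p) = \<zero>\<^bsub>M\<^esub>"
    by (auto simp: hsupp_def)
  then show "tw x y p = \<zero>\<^bsub>N\<^esub>"
    using LN.linear_zero[OF bilinear_left[OF \<beta>]] MN.linear_zero[OF bilinear_right[OF \<beta>]] assms
    by auto
qed (use assms in \<open>auto simp: bilinear_closed[OF \<beta>]\<close>)

lemma ktwist_bilinear: "is_bilinear K L M N (ktwist L M N \<beta>)"
  unfolding is_bilinear_def
proof (intro conjI ballI)
  fix x assume x: "x \<in> carrier L"
  show "is_linear K M N (ktwist L M N \<beta> x)"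
  proof (rule M.linear_by_support[OF N.module_axioms])
    fix Q :: "int set" assume "finite Q"
    then show "is_linear K M N (\<lambda>y. \<Oplus>\<^bsub>N\<^esub>p\<in>hsupp L x \<times> Q. tw x y p)"
      using L.finite_hsupp[OF x] x
      by (intro MN.is_linear_finsum MN.is_linear_ksign linear_compose[OF _ M.hcomp_linear]
          bilinear_right[OF \<beta>]) auto
  qed (use x L.finite_hsupp[OF x] in \<open>auto intro!: ktwist_superset\<close>)
next
  fix y assume y: "y \<in> carrier M"
  show "is_linear K L N (\<lambda>x. ktwist L M N \<beta> x y)"
  proof (rule L.linear_by_support[OF N.module_axioms])
    fix P :: "int set" assume "finite P"
    then show "is_linear K L N (\<lambda>x. \<Oplus>\<^bsub>N\<^esub>p\<in>P \<times> hsupp M y. tw x y p)"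
      using M.finite_hsupp[OF y] y
      by (intro LN.is_linear_finsum LN.is_linear_ksign
          linear_compose[OF bilinear_left[OF \<beta>] L.hcomp_linear]) auto
  qed (use y M.finite_hsupp[OF y] in \<open>auto intro!: ktwist_superset\<close>)
qed

lemma ktwist_homogeneous:
  assumes "x \<in> grade L p" "y \<in> grade M q"
  shows "ktwist L M N \<beta> x y = ksign N (p * q) (\<beta> x y)"
proof -
  have xy: "x \<in> carrier L" "y \<in> carrier M" using assms by auto
  have "ktwist L M N \<beta> x y = (\<Oplus>\<^bsub>N\<^esub>r\<in>{p} \<times> {q}. tw x y r)"
    using xy L.hcomp_homogeneous[OF assms(1)] M.hcomp_homogeneous[OF assms(2)]
    by (intro ktwist_superset) (auto simp: hsupp_def)
  then show ?thesis
    using xy by (simp add: L.hcomp_homogeneous[OF assms(1)] M.hcomp_homogeneous[OF assms(2)]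
        bilinear_closed[OF \<beta>])
qed

end

text \<open>
  On homogeneous elements \<open>\<beta>\<close> and \<open>\<gamma>\<close> differ by a sign, and every value of \<open>\<gamma>\<close> is a finite sum of
  values at homogeneous arguments.  The relation between \<open>\<beta>\<close> and \<open>\<gamma>\<close> is symmetric, so applying
  the lemma twice shows that a left action and its twist generate the same subgroup: one is unitary
  if and only if the other is.
\<close>
lemma generate_twisted:
  assumes \<beta>: "is_bilinear K L M N \<beta>" and \<gamma>: "is_bilinear K L M N \<gamma>"
    and sgn: "\<And>p q x y. \<lbrakk>x \<in> grade L p; y \<in> grade M q\<rbrakk> \<Longrightarrow> \<gamma> x y = ksign N (p * q) (\<beta> x y)"
  shows "generate (add_monoid N) {\<gamma> x y | x y. x \<in> carrier L \<and> y \<in> carrier M}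
    \<subseteq> generate (add_monoid N) {\<beta> x y | x y. x \<in> carrier L \<and> y \<in> carrier M}"
    (is "generate _ ?C \<subseteq> ?B")
proof -
  have B_add: "u \<oplus>\<^bsub>N\<^esub> v \<in> ?B" if "u \<in> ?B" "v \<in> ?B" for u v
    using generate.eng[OF that] by simp
  have B_zero: "\<zero>\<^bsub>N\<^esub> \<in> ?B"
    using generate.one[of "add_monoid N"] by simp
  have "\<gamma> x y \<in> ?B" if x: "x \<in> carrier L" and y: "y \<in> carrier M" for x y
    using x
  proof (induction x rule: L.homogeneous_induct)
    case (homogeneous p x)
    note x = L.grade_closed[OF homogeneous]
    show ?case using y
    proof (induction y rule: M.homogeneous_induct)
      case (homogeneous q y)
      have "\<beta> x y \<in> {\<beta> x y | x y. x \<in> carrier L \<and> y \<in> carrier M}"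
        using x M.grade_closed[OF homogeneous] by blast
      then have "\<beta> x y \<in> ?B" "\<ominus>\<^bsub>N\<^esub> \<beta> x y \<in> ?B"
        unfolding a_inv_def by (rule generate.incl, rule generate.inv)
      then show ?case
        by (simp add: sgn[OF \<open>x \<in> grade L p\<close> homogeneous] ksign_def)
    next
      case zero
      then show ?case using B_zero by (simp add: MN.linear_zero[OF bilinear_right[OF \<gamma> x]])
    next
      case (add y y')
      then show ?case using B_add
        by (simp add: linear_add[OF bilinear_right[OF \<gamma> x]])
    qed
  next
    case zero
    then show ?case using B_zero by (simp add: LN.linear_zero[OF bilinear_left[OF \<gamma> y]])
  next
    case (add x x')
    then show ?case using B_add
      by (simp add: linear_add[OF bilinear_left[OF \<gamma> y]])
  qed
  moreover have "subgroup ?B (add_monoid N)"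
    by (rule group.generate_is_subgroup[OF N.a_group]) (auto simp: bilinear_closed[OF \<beta>])
  ultimately show ?thesis
    by (intro group.generate_subgroup_incl[OF N.a_group]) auto
qed

end

section \<open>Records with the same underlying module\<close>

text \<open>
  Left and right modules live in different record types, which also carry the ring fields \<open>mult\<close> and
  \<open>one\<close>.  This relation identifies the underlying \<open>K\<close>-modules across the types, and the lemmas of
  this section show that the derived notions depend only on these, on the grading and on the differential.
\<close>
definition same_module ::
    "('k, 'a, 'y) module_scheme \<Rightarrow> ('k, 'a, 'z) module_scheme \<Rightarrow> bool" where
  "same_module M N \<longleftrightarrow> carrier M = carrier N \<and> add M = add N \<and> zero M = zero N \<and> smult M = smult N"

lemma same_module_refl: "same_module M M"
  by (simp add: same_module_def)

lemma same_module_sym: "same_module M N \<Longrightarrow> same_module N M"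
  by (simp add: same_module_def)

lemma finsum_same: "same_module M N \<Longrightarrow> finsum M f S = finsum N f S"
  by (simp add: same_module_def finsum_def finprod_def)

lemma a_inv_same: "same_module M N \<Longrightarrow> a_inv M x = a_inv N x"
  by (simp add: same_module_def a_inv_def m_inv_def)

lemma a_minus_same: "same_module M N \<Longrightarrow> a_minus M x y = a_minus N x y"
  using a_inv_same[of M N] by (simp add: same_module_def a_minus_def)

lemma ksign_same: "same_module M N \<Longrightarrow> ksign M n x = ksign N n x"
  using a_inv_same[of M N] by (simp add: ksign_def)

lemma is_decomp_same: "same_module M N \<Longrightarrow> is_decomp M I S x f = is_decomp N I S x f"
  by (simp add: is_decomp_def finsum_same[of M N]) (simp add: same_module_def)

lemma is_linear_same:
  "\<lbrakk>same_module M M'; same_module N N'\<rbrakk> \<Longrightarrow> is_linear K M N = is_linear K M' N'"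
  by (simp add: is_linear_def hom_def same_module_def fun_eq_iff)

lemma is_bilinear_same:
  "\<lbrakk>same_module L L'; same_module M M'; same_module N N'\<rbrakk>
    \<Longrightarrow> is_bilinear K L M N = is_bilinear K L' M' N'"
  using is_linear_same[of M M' N N' K] is_linear_same[of L L' N N' K]
  by (simp add: is_bilinear_def same_module_def fun_eq_iff)

lemma hcomp_same: "\<lbrakk>same_module M N; grade M = grade N\<rbrakk> \<Longrightarrow> hcomp M x = hcomp N x"
  by (simp add: hcomp_def is_decomp_same[of M N])

lemma hsupp_same: "\<lbrakk>same_module M N; grade M = grade N\<rbrakk> \<Longrightarrow> hsupp M x = hsupp N x"
  using hcomp_same[of M N x] by (simp add: hsupp_def same_module_def)

lemma generate_mono_same:
  assumes "same_module M N"
  shows "generate (add_monoid M) S \<subseteq> generate (add_monoid N) S"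
proof
  fix x assume "x \<in> generate (add_monoid M) S"
  then show "x \<in> generate (add_monoid N) S"
  proof induction
    case one
    then show ?case using generate.one[of "add_monoid N" S] assms by (simp add: same_module_def)
  next
    case (incl h)
    then show ?case by (rule generate.incl)
  next
    case (inv h)
    then show ?case
      using generate.inv[of h S "add_monoid N"] a_inv_same[OF assms] by (simp add: a_inv_def)
  next
    case (eng x y)
    then show ?case
      using generate.eng[of x "add_monoid N" S y] assms by (simp add: same_module_def)
  qed
qed

lemma generate_same:
  "same_module M N \<Longrightarrow> generate (add_monoid M) S = generate (add_monoid N) S"
  by (rule subset_antisym[OF generate_mono_same generate_mono_same[OF same_module_sym]])

lemma module_same:
  assumes "same_module M N" "module K M"
  shows "module K N"
proof -
  interpret M: module K M by fact
  have eqs: "carrier N = carrier M" "add N = add M" "zero N = zero M" "smult N = smult M"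
    using assms by (simp_all add: same_module_def)
  show ?thesis
  proof (rule moduleI)
    show "abelian_group N"
      by (rule abelian_groupI)
        (auto simp: eqs M.a_ac intro: M.a_closed bexI[of _ "\<ominus>\<^bsub>M\<^esub> _"] M.l_neg)
  qed (auto simp: eqs M.smult_l_distr M.smult_r_distr M.smult_assoc1 intro: module.axioms(1)[OF assms(2)])
qed

lemma dg_module_same:
  assumes "same_module M N" "grade M = grade N" "dif M = dif N" "dg_module K M"
  shows "dg_module K N"
proof -
  interpret M: dg_module K M by fact
  have eqs: "carrier N = carrier M" "zero N = zero M"
    using assms by (simp_all add: same_module_def)
  interpret N: module K N by (rule module_same[OF assms(1) M.module_axioms])
  show ?thesis
  proof (intro dg_module.intro graded_module.intro N.module_axioms graded_module_axioms.intro
      dg_module_axioms.intro)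
    have "submodule (grade N n) K N" for n :: int
      by (rule N.submoduleI)
        (use M.grade_closed M.grade_zero M.grade_add M.grade_neg M.grade_smult assms in
          \<open>auto simp: same_module_def a_inv_same[OF assms(1), symmetric]\<close>)
    moreover have "\<forall>x\<in>carrier M. \<exists>!f. is_decomp M UNIV (grade M) x f"
      using M.grading by (simp add: internal_direct_sum_def)
    ultimately show "internal_direct_sum K N UNIV (grade N)"
      by (simp add: internal_direct_sum_def eqs is_decomp_same[OF assms(1), symmetric] assms(2)[symmetric])
    show "is_linear K N N (dif N)"
      using M.dif_linear is_linear_same[OF assms(1) assms(1)] assms(3) by metis
  qed (use M.dif_degree M.dif_dif assms eqs in auto)
qed

section \<open>Complexes of graded maps\<close>

lemma dg_hom_simps:
  "carrier (dg_hom M N H) =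
    {(\<lambda>x\<in>carrier M. \<Oplus>\<^bsub>N\<^esub>n\<in>S. g n x) | S g. finite S \<and> (\<forall>n\<in>S. g n \<in> H n)}"
  "zero (dg_hom M N H) = (\<lambda>x\<in>carrier M. \<zero>\<^bsub>N\<^esub>)"
  "add (dg_hom M N H) = (\<lambda>f g. \<lambda>x\<in>carrier M. f x \<oplus>\<^bsub>N\<^esub> g x)"
  "smult (dg_hom M N H) = (\<lambda>k f. \<lambda>x\<in>carrier M. k \<odot>\<^bsub>N\<^esub> f x)"
  "grade (dg_hom M N H) = H"
  "dif (dg_hom M N H) = hom_dif M N H"
  by (simp_all add: dg_hom_def graded_hom_def gmodule.defs dgmodule.defs)

lemma same_module_dg_hom: "same_module (graded_hom M N H) (dg_hom M N H)"
  by (simp add: same_module_def dg_hom_simps graded_hom_def)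

lemma grade_graded_hom: "grade (graded_hom M N H) = H"
  by (simp add: graded_hom_def)

text \<open>
  What the maps of degree \<open>n\<close> between two dg modules have to satisfy in order to form a dg module of
  morphisms.  Keeping the family \<open>H\<close> abstract separates the general construction, which knows nothing
  about actions of \<open>A\<close>, from the sign computations with the action, which enter through \<open>H_dif\<close>.
\<close>
locale hom_family = M: dg_module K M + N: dg_module K N
  for K :: "('k, 'x) ring_scheme" and M :: "('k, 'm, 'y) dgmodule_scheme"
    and N :: "('k, 'm, 'z) dgmodule_scheme" +
  fixes H :: "int \<Rightarrow> ('m \<Rightarrow> 'm) set"
  assumes H_ext: "f \<in> H n \<Longrightarrow> f \<in> extensional (carrier M)"
    and H_linear: "f \<in> H n \<Longrightarrow> is_linear K M N f"
    and H_degree: "\<lbrakk>f \<in> H n; x \<in> grade M p\<rbrakk> \<Longrightarrow> f x \<in> grade N (p + n)"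
    and H_zero: "(\<lambda>x\<in>carrier M. \<zero>\<^bsub>N\<^esub>) \<in> H n"
    and H_add: "\<lbrakk>f \<in> H n; g \<in> H n\<rbrakk> \<Longrightarrow> (\<lambda>x\<in>carrier M. f x \<oplus>\<^bsub>N\<^esub> g x) \<in> H n"
    and H_smult: "\<lbrakk>k \<in> carrier K; f \<in> H n\<rbrakk> \<Longrightarrow> (\<lambda>x\<in>carrier M. k \<odot>\<^bsub>N\<^esub> f x) \<in> H n"
    and H_dif: "f \<in> H n \<Longrightarrow>
      (\<lambda>x\<in>carrier M. dif N (f x) \<ominus>\<^bsub>N\<^esub> ksign N n (f (dif M x))) \<in> H (n + 1)"
begin

sublocale two_modules K M N by unfold_locales

abbreviation P where "P \<equiv> dg_hom M N H"

lemma H_closed: "\<lbrakk>f \<in> H n; x \<in> carrier M\<rbrakk> \<Longrightarrow> f x \<in> carrier N"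
  by (rule linear_closed[OF H_linear])

text \<open>
  The index set of a sum of homogeneous maps can be enlarged at will, which allows two such sums to
  be brought to a common index set.
\<close>
lemma hom_as_sum_superset:
  assumes "f \<in> carrier P"
  shows "\<exists>S g. finite S \<and> (\<forall>n. g n \<in> H n) \<and> (\<forall>n. n \<notin> S \<longrightarrow> g n = (\<lambda>x\<in>carrier M. \<zero>\<^bsub>N\<^esub>)) \<and>
    (\<forall>T. S \<subseteq> T \<longrightarrow> finite T \<longrightarrow> f = (\<lambda>x\<in>carrier M. \<Oplus>\<^bsub>N\<^esub>n\<in>T. g n x))"
proof -
  from assms obtain S g where S: "finite S" and g: "\<And>n. n \<in> S \<Longrightarrow> g n \<in> H n"
    and f: "f = (\<lambda>x\<in>carrier M. \<Oplus>\<^bsub>N\<^esub>n\<in>S. g n x)"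
    by (auto simp: dg_hom_simps)
  define g' where "g' = (\<lambda>n. if n \<in> S then g n else (\<lambda>x\<in>carrier M. \<zero>\<^bsub>N\<^esub>))"
  have g': "g' n \<in> H n" for n by (simp add: g'_def g H_zero)
  have "(\<Oplus>\<^bsub>N\<^esub>n\<in>S. g n x) = (\<Oplus>\<^bsub>N\<^esub>n\<in>T. g' n x)"
    if "S \<subseteq> T" "finite T" "x \<in> carrier M" for T x
    by (rule N.add.finprod_mono_neutral_cong_left)
      (use that H_closed[OF g'] in \<open>auto simp: g'_def\<close>)
  then have "f = (\<lambda>x\<in>carrier M. \<Oplus>\<^bsub>N\<^esub>n\<in>T. g' n x)" if "S \<subseteq> T" "finite T" for T
    using that by (auto simp: f)
  then show ?thesis using S g' by (intro exI[of _ S] exI[of _ g']) (simp add: g'_def)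
qed

lemma hom_as_sum:
  assumes "f \<in> carrier P"
  shows "\<exists>S g. finite S \<and> (\<forall>n. g n \<in> H n) \<and> f = (\<lambda>x\<in>carrier M. \<Oplus>\<^bsub>N\<^esub>n\<in>S. g n x)"
proof -
  obtain S g where "finite S" "\<forall>n. g n \<in> H n"
    "\<forall>T. S \<subseteq> T \<longrightarrow> finite T \<longrightarrow> f = (\<lambda>x\<in>carrier M. \<Oplus>\<^bsub>N\<^esub>n\<in>T. g n x)"
    using hom_as_sum_superset[OF assms] by (elim exE conjE)
  then show ?thesis by (intro exI[of _ S] exI[of _ g]) simp
qed

lemma sum_in_hom: "\<lbrakk>finite S; \<And>n. g n \<in> H n\<rbrakk> \<Longrightarrow> (\<lambda>x\<in>carrier M. \<Oplus>\<^bsub>N\<^esub>n\<in>S. g n x) \<in> carrier P"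
  by (auto simp: dg_hom_simps)

lemma hom_extensional: "f \<in> carrier P \<Longrightarrow> f \<in> extensional (carrier M)"
  by (auto simp: dg_hom_simps)

lemma hom_linear:
  assumes "f \<in> carrier P"
  shows "is_linear K M N f"
proof -
  obtain S g where *: "finite S" "\<forall>n. g n \<in> H n" "f = (\<lambda>x\<in>carrier M. \<Oplus>\<^bsub>N\<^esub>n\<in>S. g n x)"
    using hom_as_sum[OF assms] by (elim exE conjE)
  show ?thesis
    by (rule linear_cong[OF is_linear_finsum[OF *(1) H_linear[OF *(2)[rule_format]]] M.module_axioms])
      (simp add: *(3))
qed

lemma hom_apply_closed: "\<lbrakk>f \<in> carrier P; x \<in> carrier M\<rbrakk> \<Longrightarrow> f x \<in> carrier N"
  by (rule linear_closed[OF hom_linear])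

lemma hom_eqI:
  "\<lbrakk>f \<in> carrier P; g \<in> carrier P; \<And>x. x \<in> carrier M \<Longrightarrow> f x = g x\<rbrakk> \<Longrightarrow> f = g"
  by (rule extensionalityI[OF hom_extensional hom_extensional])

lemma homogeneous_in_hom: "f \<in> H n \<Longrightarrow> f \<in> carrier P"
proof -
  assume f: "f \<in> H n"
  have "f = (\<lambda>x\<in>carrier M. \<Oplus>\<^bsub>N\<^esub>m\<in>{n}. f x)"
    by (rule extensionalityI[OF H_ext[OF f]]) (auto simp: H_closed[OF f])
  then show "f \<in> carrier P"
    using f unfolding dg_hom_simps by (intro CollectI exI[of _ "{n}"] exI[of _ "\<lambda>_. f"]) auto
qed

lemma hom_add_closed:
  assumes "f \<in> carrier P" "f' \<in> carrier P"
  shows "(\<lambda>x\<in>carrier M. f x \<oplus>\<^bsub>N\<^esub> f' x) \<in> carrier P"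
proof -
  obtain S g where g: "finite S" "\<forall>n. g n \<in> H n"
    "\<forall>T. S \<subseteq> T \<longrightarrow> finite T \<longrightarrow> f = (\<lambda>x\<in>carrier M. \<Oplus>\<^bsub>N\<^esub>n\<in>T. g n x)"
    using hom_as_sum_superset[OF assms(1)] by (elim exE conjE)
  obtain S' g' where g': "finite S'" "\<forall>n. g' n \<in> H n"
    "\<forall>T. S' \<subseteq> T \<longrightarrow> finite T \<longrightarrow> f' = (\<lambda>x\<in>carrier M. \<Oplus>\<^bsub>N\<^esub>n\<in>T. g' n x)"
    using hom_as_sum_superset[OF assms(2)] by (elim exE conjE)
  let ?T = "S \<union> S'"
  have "(\<lambda>x\<in>carrier M. f x \<oplus>\<^bsub>N\<^esub> f' x) =
      (\<lambda>x\<in>carrier M. \<Oplus>\<^bsub>N\<^esub>n\<in>?T. (\<lambda>x\<in>carrier M. g n x \<oplus>\<^bsub>N\<^esub> g' n x) x)"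
  proof (rule restrict_ext)
    fix x assume x: "x \<in> carrier M"
    have "f x = (\<Oplus>\<^bsub>N\<^esub>n\<in>?T. g n x)" "f' x = (\<Oplus>\<^bsub>N\<^esub>n\<in>?T. g' n x)"
      using x g(1) g'(1) by (subst g(3)[rule_format, of ?T] g'(3)[rule_format, of ?T]; simp)+
    then show "f x \<oplus>\<^bsub>N\<^esub> f' x = (\<Oplus>\<^bsub>N\<^esub>n\<in>?T. (\<lambda>x\<in>carrier M. g n x \<oplus>\<^bsub>N\<^esub> g' n x) x)"
      using x H_closed[OF g(2)[rule_format] x] H_closed[OF g'(2)[rule_format] x] by (simp add: N.finsum_addf)
  qed
  also have "\<dots> \<in> carrier P"
    using g g' by (intro sum_in_hom H_add) auto
  finally show ?thesis .
qed

lemma hom_smult_closed: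
  assumes k: "k \<in> carrier K" and f: "f \<in> carrier P"
  shows "(\<lambda>x\<in>carrier M. k \<odot>\<^bsub>N\<^esub> f x) \<in> carrier P"
proof -
  obtain S g where g: "finite S" "\<forall>n. g n \<in> H n" "f = (\<lambda>x\<in>carrier M. \<Oplus>\<^bsub>N\<^esub>n\<in>S. g n x)"
    using hom_as_sum[OF f] by (elim exE conjE)
  interpret NN: two_modules K N N by unfold_locales
  have "(\<lambda>x\<in>carrier M. k \<odot>\<^bsub>N\<^esub> f x) =
      (\<lambda>x\<in>carrier M. \<Oplus>\<^bsub>N\<^esub>n\<in>S. (\<lambda>x\<in>carrier M. k \<odot>\<^bsub>N\<^esub> g n x) x)"
    using g by (intro restrict_ext) (simp add: NN.linear_finsum[OF N.is_linear_smult[OF k]] H_closed[OF g(2)[rule_format]])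
  also have "\<dots> \<in> carrier P"
    using g k by (intro sum_in_hom H_smult) auto
  finally show ?thesis .
qed

lemma hom_zero_closed: "(\<lambda>x\<in>carrier M. \<zero>\<^bsub>N\<^esub>) \<in> carrier P"
  by (rule homogeneous_in_hom[OF H_zero])

lemma hom_module: "module K P"
proof (rule moduleI)
  show "cring K" by (rule module.axioms(1)[OF M.module_axioms])
  show "abelian_group P"
  proof (rule abelian_groupI)
    fix f assume f: "f \<in> carrier P"
    show "\<exists>g\<in>carrier P. g \<oplus>\<^bsub>P\<^esub> f = \<zero>\<^bsub>P\<^esub>"
    proof
      (* Negation is scalar multiplication by -1, under which the families H n are closed. *)
      show "(\<lambda>x\<in>carrier M. (\<ominus>\<^bsub>K\<^esub> \<one>\<^bsub>K\<^esub>) \<odot>\<^bsub>N\<^esub> f x) \<in> carrier P"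
        by (rule hom_smult_closed[OF _ f]) simp
      show "(\<lambda>x\<in>carrier M. (\<ominus>\<^bsub>K\<^esub> \<one>\<^bsub>K\<^esub>) \<odot>\<^bsub>N\<^esub> f x) \<oplus>\<^bsub>P\<^esub> f = \<zero>\<^bsub>P\<^esub>"
        unfolding dg_hom_simps
        by (rule restrict_ext) (simp add: hom_apply_closed[OF f] N.smult_l_minus N.l_neg)
    qed
  qed (auto simp: dg_hom_simps(2,3) hom_add_closed hom_zero_closed hom_apply_closed N.a_ac intro!: restrict_ext
      intro: extensionalityI[OF _ hom_extensional])
qed (auto simp: dg_hom_simps(3,4) hom_smult_closed hom_apply_closed N.smult_l_distr N.smult_r_distr N.smult_assoc1
    intro!: restrict_ext intro: extensionalityI[OF _ hom_extensional])

sublocale P: module K P by (rule hom_module)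

lemma hom_finsum:
  assumes "finite S" "\<And>n. n \<in> S \<Longrightarrow> g n \<in> carrier P"
  shows "(\<Oplus>\<^bsub>P\<^esub>n\<in>S. g n) = (\<lambda>x\<in>carrier M. \<Oplus>\<^bsub>N\<^esub>n\<in>S. g n x)"
  using assms
proof (induction S)
  case empty
  then show ?case by (simp add: dg_hom_simps(2))
next
  case (insert a S)
  then have "(\<Oplus>\<^bsub>P\<^esub>n\<in>insert a S. g n) = g a \<oplus>\<^bsub>P\<^esub> (\<lambda>x\<in>carrier M. \<Oplus>\<^bsub>N\<^esub>n\<in>S. g n x)"
    by (subst P.finsum_insert) (auto simp del: restrict_apply)
  also have "\<dots> = (\<lambda>x\<in>carrier M. \<Oplus>\<^bsub>N\<^esub>n\<in>insert a S. g n x)"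
    unfolding dg_hom_simps
    by (rule restrict_ext) (use insert hom_apply_closed in \<open>auto intro!: N.finsum_insert[symmetric]\<close>)
  finally show ?case .
qed

lemma hom_neg: "f \<in> carrier P \<Longrightarrow> \<ominus>\<^bsub>P\<^esub> f = (\<ominus>\<^bsub>K\<^esub> \<one>\<^bsub>K\<^esub>) \<odot>\<^bsub>P\<^esub> f"
  by (simp add: P.smult_l_minus)

lemma eval_linear: "x \<in> carrier M \<Longrightarrow> is_linear K P N (\<lambda>f. f x)"
  by (rule is_linearI) (auto simp: hom_apply_closed dg_hom_simps(3,4))

lemma H_submodule: "submodule (H n) K P"
proof (rule P.submoduleI)
  show "H n \<subseteq> carrier P" using homogeneous_in_hom by auto
  show "\<zero>\<^bsub>P\<^esub> \<in> H n" by (simp add: dg_hom_simps(2) H_zero)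
  show "k \<odot>\<^bsub>P\<^esub> f \<in> H n" if "k \<in> carrier K" "f \<in> H n" for k f
    using H_smult[OF that] by (simp add: dg_hom_simps(4))
  then show "\<ominus>\<^bsub>P\<^esub> f \<in> H n" if "f \<in> H n" for f
    using that by (simp add: hom_neg[OF homogeneous_in_hom[OF that]])
  show "f \<oplus>\<^bsub>P\<^esub> g \<in> H n" if "f \<in> H n" "g \<in> H n" for f g
    using H_add[OF that] by (simp add: dg_hom_simps(3))
qed

text \<open>
  The reason why homogeneous maps of different degrees are independent: evaluated at an element of
  degree \<open>p\<close>, a decomposition of \<open>f\<close> becomes the decomposition of \<open>f x\<close> in \<open>N\<close> shifted by \<open>p\<close>.  So
  the components of \<open>f\<close> are determined on homogeneous elements, hence everywhere.
\<close>
lemma decomp_apply: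
  assumes u: "is_decomp P UNIV H f u" and x: "x \<in> grade M p"
  shows "u n x = hcomp N (f x) (p + n)"
proof -
  have xM: "x \<in> carrier M" using x by auto
  let ?S = "{n. u n \<noteq> \<zero>\<^bsub>P\<^esub>}"
  have uH: "u n \<in> H n" for n using u by (simp add: is_decomp_def)
  have S: "finite ?S" using u by (simp add: is_decomp_def)
  have "f = (\<Oplus>\<^bsub>P\<^esub>n\<in>?S. u n)" using u unfolding is_decomp_def by blast
  then have "f x = (\<Oplus>\<^bsub>N\<^esub>n\<in>?S. u n x)"
    using hom_finsum[OF S, of u] homogeneous_in_hom[OF uH] xM by simp
  also have "\<dots> = (\<Oplus>\<^bsub>N\<^esub>m\<in>(\<lambda>n. p + n) ` ?S. u (m - p) x)"
    by (subst N.finsum_reindex) (use H_closed[OF uH xM] in \<open>auto simp: inj_on_def\<close>)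
  finally have fx: "f x = (\<Oplus>\<^bsub>N\<^esub>m\<in>(\<lambda>n. p + n) ` ?S. u (m - p) x)" .
  have "is_decomp N UNIV (grade N) (f x) (\<lambda>m. u (m - p) x)"
  proof (rule N.is_decompI[OF _ _ _ fx])
    show "u (m - p) x \<in> grade N m" for m
      using H_degree[OF uH[of "m - p"] x] by simp
    show "u (m - p) x = \<zero>\<^bsub>N\<^esub>" if "m \<notin> (\<lambda>n. p + n) ` ?S" for m
    proof -
      have "m = p + (m - p)" by simp
      then have "m - p \<notin> ?S" using that by blast
      then show ?thesis using xM by (simp add: dg_hom_simps(2))
    qed
  qed (use S in simp)
  moreover have "f x \<in> carrier N"
    unfolding fx by (rule N.finsum_closed) (use H_closed[OF uH xM] in auto)
  ultimately show ?thesis by (simp add: N.hcomp_eqI)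
qed

lemma hom_grading: "internal_direct_sum K P UNIV H"
  unfolding internal_direct_sum_def
proof (intro conjI ballI)
  fix f assume f: "f \<in> carrier P"
  obtain S g where g: "finite S" "\<forall>n. g n \<in> H n" "\<forall>n. n \<notin> S \<longrightarrow> g n = (\<lambda>x\<in>carrier M. \<zero>\<^bsub>N\<^esub>)"
    "\<forall>T. S \<subseteq> T \<longrightarrow> finite T \<longrightarrow> f = (\<lambda>x\<in>carrier M. \<Oplus>\<^bsub>N\<^esub>n\<in>T. g n x)"
    using hom_as_sum_superset[OF f] by (elim exE conjE)
  let ?T = "{n. g n \<noteq> \<zero>\<^bsub>P\<^esub>}"
  have gP: "g n \<in> carrier P" for n using g(2) homogeneous_in_hom by auto
  have T: "?T \<subseteq> S" using g(3) by (auto simp: dg_hom_simps(2))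
  have "f = (\<Oplus>\<^bsub>P\<^esub>n\<in>S. g n)"
    using g(4) g(1) hom_finsum[of S g] gP by simp
  also have "\<dots> = (\<Oplus>\<^bsub>P\<^esub>n\<in>?T. g n)"
    by (rule P.add.finprod_mono_neutral_cong_right) (use g T gP in auto)
  finally have dec: "is_decomp P UNIV H f g"
    using g finite_subset[OF T] by (simp add: is_decomp_def)
  show "\<exists>!u. is_decomp P UNIV H f u"
  proof (rule ex1I, rule dec)
    fix u assume u: "is_decomp P UNIV H f u"
    have uP: "u n \<in> H n" for n using u by (simp add: is_decomp_def)
    show "u = g"
    proof
      fix n
      show "u n = g n"
      proof (rule hom_eqI[OF homogeneous_in_hom[OF uP] gP])
        fix x assume "x \<in> carrier M"
        then show "u n x = g n x"
          by (rule M.linear_eq_homogeneous[OF H_linear[OF uP] hom_linear[OF gP] N.module_axioms, rotated])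
            (simp add: decomp_apply[OF u] decomp_apply[OF dec])
      qed
    qed
  qed
qed (rule H_submodule)

sublocale P: graded_module K P
  by unfold_locales (use hom_grading in \<open>simp add: dg_hom_simps(5)\<close>)

text \<open>
  Pointwise, the second term of the differential is a linear extension of a rule for homogeneous
  maps; linearity of the differential follows from this form.
\<close>
lemma hom_dif_eq:
  assumes x: "x \<in> carrier M"
  shows "hom_dif M N H f x =
    dif N (f x) \<ominus>\<^bsub>N\<^esub> hext P N (\<lambda>n f. ksign N n (f (dif M x))) f"
  using x hcomp_same[OF same_module_dg_hom, of M N H f] hsupp_same[OF same_module_dg_hom, of M N H f]
  by (simp add: hom_dif_def hext_def dg_hom_simps(5) grade_graded_hom)

lemma hom_dif_ext: "hom_dif M N H f \<in> extensional (carrier M)"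
  by (simp add: hom_dif_def)

lemma hext_maps_eval: "x \<in> carrier M \<Longrightarrow> hext_maps K P N (\<lambda>n f. ksign N n (f x))"
proof -
  assume x: "x \<in> carrier M"
  interpret PN: two_modules K P N by unfold_locales
  show ?thesis
    by unfold_locales (rule PN.is_linear_ksign[OF eval_linear[OF x]])
qed

lemma dif_closed: "x \<in> carrier M \<Longrightarrow> dif M x \<in> carrier M"
  by (rule linear_closed[OF M.dif_linear])

lemma hom_dif_eval_linear:
  assumes x: "x \<in> carrier M"
  shows "is_linear K P N (\<lambda>f. hom_dif M N H f x)"
proof -
  interpret PN: two_modules K P N by unfold_locales
  show ?thesis unfolding hom_dif_eq[OF x]
    by (intro PN.is_linear_diff linear_compose[OF N.dif_linear eval_linear[OF x]]
        hext_maps.hext_linear hext_maps_eval dif_closed x)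
qed

lemma hom_dif_homogeneous_apply:
  assumes f: "f \<in> H n" and x: "x \<in> carrier M"
  shows "hom_dif M N H f x = dif N (f x) \<ominus>\<^bsub>N\<^esub> ksign N n (f (dif M x))"
  unfolding hom_dif_eq[OF x]
  using f by (subst hext_maps.hext_homogeneous[OF hext_maps_eval[OF dif_closed[OF x]]])
    (simp_all add: dg_hom_simps(5))

lemma hom_dif_homogeneous:
  assumes f: "f \<in> H n"
  shows "hom_dif M N H f = (\<lambda>x\<in>carrier M. dif N (f x) \<ominus>\<^bsub>N\<^esub> ksign N n (f (dif M x)))"
  by (rule extensionalityI[OF hom_dif_ext restrict_extensional])
    (simp add: hom_dif_homogeneous_apply[OF f])

lemma hom_dif_degree: "f \<in> H n \<Longrightarrow> hom_dif M N H f \<in> H (n + 1)"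
  by (simp add: hom_dif_homogeneous H_dif)

lemma hom_dif_closed: "f \<in> carrier P \<Longrightarrow> hom_dif M N H f \<in> carrier P"
proof (induction f rule: P.homogeneous_induct)
  case (homogeneous n f)
  then show ?case using homogeneous_in_hom[OF hom_dif_degree[of f n]] by (simp add: dg_hom_simps(5))
next
  case zero
  have "\<zero>\<^bsub>P\<^esub> \<in> H 0" using P.grade_zero by (simp add: dg_hom_simps(5))
  then show ?case by (rule homogeneous_in_hom[OF hom_dif_degree])
next
  case (add f g)
  have "hom_dif M N H (f \<oplus>\<^bsub>P\<^esub> g) = hom_dif M N H f \<oplus>\<^bsub>P\<^esub> hom_dif M N H g"
  proof (rule extensionalityI[OF hom_dif_ext hom_extensional])
    show "hom_dif M N H f \<oplus>\<^bsub>P\<^esub> hom_dif M N H g \<in> carrier P" using add by simp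
    show "hom_dif M N H (f \<oplus>\<^bsub>P\<^esub> g) x = (hom_dif M N H f \<oplus>\<^bsub>P\<^esub> hom_dif M N H g) x"
      if "x \<in> carrier M" for x
      using linear_add[OF hom_dif_eval_linear[OF that] add(1,2)] that by (simp add: dg_hom_simps(3))
  qed
  then show ?case using add by simp
qed

lemma linear_into_homI:
  assumes "\<And>u. u \<in> carrier L \<Longrightarrow> F u \<in> carrier P"
    and "\<And>x. x \<in> carrier M \<Longrightarrow> is_linear K L N (\<lambda>u. F u x)"
    and L: "module K L"
  shows "is_linear K L P F"
proof -
  interpret L: module K L by (rule L)
  show ?thesis
  proof (rule is_linearI)
    show "F (u \<oplus>\<^bsub>L\<^esub> v) = F u \<oplus>\<^bsub>P\<^esub> F v" if "u \<in> carrier L" "v \<in> carrier L" for u v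
      by (rule hom_eqI) (use that assms linear_add[OF assms(2)] in \<open>auto simp: dg_hom_simps(3) intro: hom_add_closed\<close>)
    show "F (k \<odot>\<^bsub>L\<^esub> u) = k \<odot>\<^bsub>P\<^esub> F u" if "k \<in> carrier K" "u \<in> carrier L" for k u
      by (rule hom_eqI) (use that assms linear_smult[OF assms(2)] in \<open>auto simp: dg_hom_simps(4) intro: hom_smult_closed\<close>)
  qed (rule assms(1))
qed

lemma hom_dif_linear: "is_linear K P P (hom_dif M N H)"
  by (intro linear_into_homI hom_dif_closed hom_dif_eval_linear P.module_axioms)

text \<open>
  The two mixed terms \<open>(-1)\<^sup>n d \<circ> f \<circ> d\<close> cancel because the differential raises the degree of \<open>f\<close> by
  one, which flips the sign.
\<close>
lemma hom_dif_hom_dif_homogeneous: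
  assumes f: "f \<in> H n"
  shows "hom_dif M N H (hom_dif M N H f) = \<zero>\<^bsub>P\<^esub>"
proof (rule hom_eqI)
  note Df = hom_dif_degree[OF f]
  show "hom_dif M N H (hom_dif M N H f) \<in> carrier P" by (rule homogeneous_in_hom[OF hom_dif_degree[OF Df]])
  fix x assume x: "x \<in> carrier M"
  note dx = dif_closed[OF x]
  interpret NN: two_modules K N N by unfold_locales
  have c: "f x \<in> carrier N" "f (dif M x) \<in> carrier N" "dif N (f x) \<in> carrier N"
    "dif N (f (dif M x)) \<in> carrier N"
    using x dx H_closed[OF f] linear_closed[OF N.dif_linear] by auto
  have "hom_dif M N H (hom_dif M N H f) x =
    dif N (hom_dif M N H f x) \<ominus>\<^bsub>N\<^esub> ksign N (n + 1) (hom_dif M N H f (dif M x))"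
    by (rule hom_dif_homogeneous_apply[OF Df x])
  also have "dif N (hom_dif M N H f x) = \<ominus>\<^bsub>N\<^esub> ksign N n (dif N (f (dif M x)))"
    using c by (simp add: hom_dif_homogeneous_apply[OF f x] NN.linear_diff[OF N.dif_linear]
        N.dif_dif NN.linear_ksign[OF N.dif_linear]) (simp add: N.minus_eq)
  also have "hom_dif M N H f (dif M x) = dif N (f (dif M x))"
    using c by (simp add: hom_dif_homogeneous_apply[OF f dx] M.dif_dif[OF x] linear_zero[OF H_linear[OF f]]
        N.minus_eq)
  also have "\<ominus>\<^bsub>N\<^esub> ksign N n (dif N (f (dif M x))) \<ominus>\<^bsub>N\<^esub> ksign N (n + 1) (dif N (f (dif M x))) = \<zero>\<^bsub>N\<^esub>"
    using c by (simp add: N.minus_ksign N.minus_eq ksign_def N.r_neg N.l_neg)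
  finally show "hom_dif M N H (hom_dif M N H f) x = \<zero>\<^bsub>P\<^esub> x"
    using x by (simp add: dg_hom_simps(2))
qed simp

lemma hom_dg_module: "dg_module K P"
proof (intro dg_module.intro P.graded_module_axioms dg_module_axioms.intro)
  show "is_linear K P P (dif P)"
    by (simp add: dg_hom_simps(6) hom_dif_linear)
  show "dif P f \<in> grade P (n + 1)" if "f \<in> grade P n" for f n
    using that hom_dif_degree by (simp add: dg_hom_simps(5,6))
  show "dif P (dif P f) = \<zero>\<^bsub>P\<^esub>" if f: "f \<in> carrier P" for f
    unfolding dg_hom_simps(6)
  proof (rule P.linear_eq_homogeneous[OF linear_compose[OF hom_dif_linear hom_dif_linear] _
        P.module_axioms _ f, where g = "\<lambda>_. \<zero>\<^bsub>P\<^esub>"])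
    interpret PP: two_modules K P P by unfold_locales
    show "is_linear K P P (\<lambda>_. \<zero>\<^bsub>P\<^esub>)" by (rule PP.is_linear_zero_map)
  qed (simp add: hom_dif_hom_dif_homogeneous dg_hom_simps(5))
qed

end

section \<open>Composition\<close>

locale hom_composition =
  LM: hom_family K L M H1 + MN: hom_family K M N H2 + LN: hom_family K L N H3
  for K :: "('k, 'x) ring_scheme" and L :: "('k, 'm, 'u) dgmodule_scheme"
    and M :: "('k, 'm, 'y) dgmodule_scheme" and N :: "('k, 'm, 'z) dgmodule_scheme"
    and H1 H2 H3 :: "int \<Rightarrow> ('m \<Rightarrow> 'm) set" +
  assumes compose_degree: "\<lbrakk>g \<in> H2 m; f \<in> H1 n\<rbrakk> \<Longrightarrow> compose (carrier L) g f \<in> H3 (m + n)"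
begin

lemma compose_closed:
  assumes g: "g \<in> carrier MN.P" and f: "f \<in> carrier LM.P"
  shows "compose (carrier L) g f \<in> carrier LN.P"
  using g
proof (induction g rule: MN.P.homogeneous_induct)
  case (homogeneous m g)
  note gl = MN.H_linear[OF homogeneous[unfolded dg_hom_simps(5)]]
  show ?case using f
  proof (induction f rule: LM.P.homogeneous_induct)
    case (homogeneous n f)
    then show ?case
      using compose_degree[of g m f n] \<open>g \<in> grade MN.P m\<close>
      by (intro LN.homogeneous_in_hom[of _ "m + n"]) (simp add: dg_hom_simps(5))
  next
    case zero
    have "compose (carrier L) g \<zero>\<^bsub>LM.P\<^esub> = \<zero>\<^bsub>LN.P\<^esub>"
      unfolding compose_def dg_hom_simps(2) by (rule restrict_ext) (simp add: MN.linear_zero[OF gl])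
    then show ?case by simp
  next
    case (add f f')
    have "compose (carrier L) g (f \<oplus>\<^bsub>LM.P\<^esub> f') =
      compose (carrier L) g f \<oplus>\<^bsub>LN.P\<^esub> compose (carrier L) g f'"
      unfolding compose_def dg_hom_simps(3)
      by (rule restrict_ext) (simp add: linear_add[OF gl] LM.hom_apply_closed add)
    then show ?case using add by simp
  qed
next
  case zero
  have "compose (carrier L) \<zero>\<^bsub>MN.P\<^esub> f = \<zero>\<^bsub>LN.P\<^esub>"
    unfolding compose_def dg_hom_simps(2) by (rule restrict_ext) (simp add: LM.hom_apply_closed[OF f])
  then show ?case by simp
next
  case (add g g')
  have "compose (carrier L) (g \<oplus>\<^bsub>MN.P\<^esub> g') f =
    compose (carrier L) g f \<oplus>\<^bsub>LN.P\<^esub> compose (carrier L) g' f"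
    unfolding compose_def dg_hom_simps(3) by (rule restrict_ext) (simp add: LM.hom_apply_closed[OF f])
  then show ?case using add by simp
qed

lemma compose_bilinear: "is_bilinear K MN.P LM.P LN.P (compose (carrier L))"
  unfolding is_bilinear_def
proof (intro conjI ballI)
  fix g assume g: "g \<in> carrier MN.P"
  show "is_linear K LM.P LN.P (compose (carrier L) g)"
  proof (intro LN.linear_into_homI compose_closed[OF g] LM.P.module_axioms)
    show "is_linear K LM.P N (\<lambda>f. compose (carrier L) g f x)" if x: "x \<in> carrier L" for x
      using linear_compose[OF MN.hom_linear[OF g] LM.eval_linear[OF x]] x by (simp add: compose_eq)
  qed
next
  fix f assume f: "f \<in> carrier LM.P"
  show "is_linear K MN.P LN.P (\<lambda>g. compose (carrier L) g f)"
  proof (intro LN.linear_into_homI compose_closed[OF _ f] MN.P.module_axioms)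
    show "is_linear K MN.P N (\<lambda>g. compose (carrier L) g f x)" if x: "x \<in> carrier L" for x
      using MN.eval_linear[OF LM.hom_apply_closed[OF f x]] x by (simp add: compose_eq)
  qed
qed

text \<open>
  Both sides are linear in \<open>f\<close>, so \<open>f\<close> may be taken homogeneous.  Then the right-hand side is
  \<open>(d g f - (-1)\<^sup>m g d f) + (-1)\<^sup>m (g d f - (-1)\<^sup>n g f d)\<close>, where the middle terms cancel.
\<close>
lemma compose_leibniz:
  assumes g: "g \<in> H2 m" and f: "f \<in> carrier LM.P"
  shows "hom_dif L N H3 (compose (carrier L) g f) =
    compose (carrier L) (hom_dif M N H2 g) f
    \<oplus>\<^bsub>LN.P\<^esub> ksign LN.P m (compose (carrier L) g (hom_dif L M H1 f))"
proof (rule LM.P.linear_eq_homogeneous[OF _ _ LN.P.module_axioms _ f])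
  interpret PP: two_modules K LM.P LN.P by unfold_locales
  note gl = MN.H_linear[OF g]
  have gP: "g \<in> carrier MN.P" "hom_dif M N H2 g \<in> carrier MN.P"
    by (simp_all add: MN.homogeneous_in_hom[OF g] MN.homogeneous_in_hom[OF MN.hom_dif_degree[OF g]])
  show "is_linear K LM.P LN.P (\<lambda>f. hom_dif L N H3 (compose (carrier L) g f))"
    by (rule linear_compose[OF LN.hom_dif_linear bilinear_right[OF compose_bilinear gP(1)]])
  show "is_linear K LM.P LN.P (\<lambda>f. compose (carrier L) (hom_dif M N H2 g) f
      \<oplus>\<^bsub>LN.P\<^esub> ksign LN.P m (compose (carrier L) g (hom_dif L M H1 f)))"
    by (intro PP.is_linear_add PP.is_linear_ksign bilinear_right[OF compose_bilinear gP(2)]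
        linear_compose[OF bilinear_right[OF compose_bilinear gP(1)] LM.hom_dif_linear])
  fix n f assume "f \<in> grade LM.P n"
  then have f: "f \<in> H1 n" by (simp add: dg_hom_simps(5))
  note fP = LM.homogeneous_in_hom[OF f]
  note DfP = LM.hom_dif_closed[OF fP]
  show "hom_dif L N H3 (compose (carrier L) g f) = compose (carrier L) (hom_dif M N H2 g) f
      \<oplus>\<^bsub>LN.P\<^esub> ksign LN.P m (compose (carrier L) g (hom_dif L M H1 f))" (is "?l = ?u \<oplus>\<^bsub>_\<^esub> ksign _ m ?v")
  proof (rule LN.hom_eqI)
    have u: "?u \<in> carrier LN.P" by (rule compose_closed[OF gP(2) fP])
    have v: "?v \<in> carrier LN.P" by (rule compose_closed[OF gP(1) DfP])
    show "?l \<in> carrier LN.P" by (rule LN.hom_dif_closed[OF compose_closed[OF gP(1) fP]])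
    show "?u \<oplus>\<^bsub>LN.P\<^esub> ksign LN.P m ?v \<in> carrier LN.P" using u v by simp
    fix x assume x: "x \<in> carrier L"
    note dx = LM.dif_closed[OF x]
    interpret E: two_modules K LN.P N by unfold_locales
    note ev = LN.eval_linear[OF x]
    have c: "f x \<in> carrier M" "f (dif L x) \<in> carrier M" "dif M (f x) \<in> carrier M"
      using LM.H_closed[OF f] x dx MN.dif_closed by auto
    have c': "g (dif M (f x)) \<in> carrier N" "g (f (dif L x)) \<in> carrier N" "dif N (g (f x)) \<in> carrier N"
      using MN.H_closed[OF g] c linear_closed[OF MN.N.dif_linear] by auto
    have "?l x = dif N (g (f x)) \<ominus>\<^bsub>N\<^esub> ksign N (m + n) (g (f (dif L x)))"
      using x dx by (simp add: LN.hom_dif_homogeneous_apply[OF compose_degree[OF g f]] compose_eq)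
    moreover have "?u x = dif N (g (f x)) \<ominus>\<^bsub>N\<^esub> ksign N m (g (dif M (f x)))"
      using x c by (simp add: compose_eq MN.hom_dif_homogeneous_apply[OF g])
    moreover have "ksign LN.P m ?v x =
        ksign N m (g (dif M (f x))) \<ominus>\<^bsub>N\<^esub> ksign N (m + n) (g (f (dif L x)))"
      using x dx c c' by (simp add: E.linear_ksign[OF ev v] compose_eq LM.hom_dif_homogeneous_apply[OF f]
          MN.linear_diff[OF gl] MN.linear_ksign[OF gl] MN.N.minus_eq MN.N.ksign_add
          MN.N.ksign_ksign MN.N.minus_ksign algebra_simps)
    moreover have "(?u \<oplus>\<^bsub>LN.P\<^esub> ksign LN.P m ?v) x = ?u x \<oplus>\<^bsub>N\<^esub> ksign LN.P m ?v x"
      by (rule linear_add[OF ev u LN.P.ksign_closed[OF v]])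
    ultimately show "?l x = (?u \<oplus>\<^bsub>LN.P\<^esub> ksign LN.P m ?v) x"
      using c' by (simp add: MN.N.minus_eq MN.N.a_assoc MN.N.r_neg1)
  qed
qed

end

section \<open>Left modules and right modules over the opposite algebra\<close>

lemma trilinear_eq_homogeneous:
  assumes "graded_module K L1" "graded_module K L2" "graded_module K L3" "module K N"
    and F: "\<And>y z. \<lbrakk>y \<in> carrier L2; z \<in> carrier L3\<rbrakk> \<Longrightarrow> is_linear K L1 N (\<lambda>x. F x y z)"
      "\<And>x z. \<lbrakk>x \<in> carrier L1; z \<in> carrier L3\<rbrakk> \<Longrightarrow> is_linear K L2 N (\<lambda>y. F x y z)"
      "\<And>x y. \<lbrakk>x \<in> carrier L1; y \<in> carrier L2\<rbrakk> \<Longrightarrow> is_linear K L3 N (\<lambda>z. F x y z)"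
    and G: "\<And>y z. \<lbrakk>y \<in> carrier L2; z \<in> carrier L3\<rbrakk> \<Longrightarrow> is_linear K L1 N (\<lambda>x. G x y z)"
      "\<And>x z. \<lbrakk>x \<in> carrier L1; z \<in> carrier L3\<rbrakk> \<Longrightarrow> is_linear K L2 N (\<lambda>y. G x y z)"
      "\<And>x y. \<lbrakk>x \<in> carrier L1; y \<in> carrier L2\<rbrakk> \<Longrightarrow> is_linear K L3 N (\<lambda>z. G x y z)"
    and eq: "\<And>p q r x y z. \<lbrakk>x \<in> grade L1 p; y \<in> grade L2 q; z \<in> grade L3 r\<rbrakk> \<Longrightarrow> F x y z = G x y z"
    and x: "x \<in> carrier L1" and y: "y \<in> carrier L2" and z: "z \<in> carrier L3"
  shows "F x y z = G x y z"
proof -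
  interpret L1: graded_module K L1 by fact
  interpret L2: graded_module K L2 by fact
  interpret L3: graded_module K L3 by fact
  show ?thesis
  proof (rule L1.linear_eq_homogeneous[OF F(1)[OF y z] G(1)[OF y z] assms(4) _ x])
    fix p x assume x: "x \<in> grade L1 p"
    note xc = L1.grade_closed[OF x]
    show "F x y z = G x y z"
    proof (rule L2.linear_eq_homogeneous[OF F(2)[OF xc z] G(2)[OF xc z] assms(4) _ y])
      fix q y assume y: "y \<in> grade L2 q"
      note yc = L2.grade_closed[OF y]
      show "F x y z = G x y z"
        by (rule L3.linear_eq_homogeneous[OF F(3)[OF xc yc] G(3)[OF xc yc] assms(4) eq[OF x y] z])
    qed
  qed
qed

lemma dg_op_simps [simp]:
  "carrier (dg_op A) = carrier A" "grade (dg_op A) = grade A" "dif (dg_op A) = dif A"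
  by (simp_all add: dg_op_def)

lemma same_module_dg_op: "same_module A (dg_op A)"
  by (simp add: same_module_def dg_op_def)

lemma dg_op_mult: "mult (dg_op A) = ktwist A A A (\<lambda>a b. b \<otimes>\<^bsub>A\<^esub> a)"
  by (simp add: dg_op_def ktwist_def fun_eq_iff)

context dg_algebra_enough_idempotents
begin

sublocale AA: graded_pair K A A A by unfold_locales

lemma mult_flip_bilinear: "is_bilinear K A A A (\<lambda>a b. b \<otimes>\<^bsub>A\<^esub> a)"
  using is_bilinear_flip[OF mult_bilinear] .

lemma op_mult_bilinear: "is_bilinear K A A A (mult (dg_op A))"
  unfolding dg_op_mult by (rule AA.ktwist_bilinear[OF mult_flip_bilinear])

lemma op_mult_homogeneous:
  "\<lbrakk>a \<in> grade A p; b \<in> grade A q\<rbrakk> \<Longrightarrow> a \<otimes>\<^bsub>dg_op A\<^esub> b = ksign A (p * q) (b \<otimes>\<^bsub>A\<^esub> a)"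
  unfolding dg_op_mult by (rule AA.ktwist_homogeneous[OF mult_flip_bilinear])

end

text \<open>
  \<open>N\<close> is \<open>M\<close> with the right action \<open>x a\<^sup>o = (-1)\<^bsup>|x||a|\<^esup> a x\<close>.  Formulated as a relation rather than as a
  function, it is symmetric in the two kinds of modules, so that the facts about it serve both for
  the functor and for its inverse.
\<close>
definition koszul_mates ::
    "('k, 'a) dgmodule \<Rightarrow> ('k, 'a, 'm) left_dgmodule \<Rightarrow> ('k, 'a, 'm) right_dgmodule \<Rightarrow> bool" where
  "koszul_mates A M N \<longleftrightarrow> same_module M N \<and> grade M = grade N \<and> dif M = dif N \<and>
     (\<forall>p q. \<forall>x\<in>grade M p. \<forall>a\<in>grade A q. ract N x a = ksign M (p * q) (lact M a x))"

text \<open>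
  A dg module with a bilinear left action and its twist, before it is known whether either of them
  is a module structure.
\<close>
locale mate_actions = alg: dg_algebra_enough_idempotents K A I e + M: dg_module K M
  for K :: "('k, 'x) ring_scheme" and A :: "('k, 'a) dgmodule" and I :: "'i set" and e :: "'i \<Rightarrow> 'a"
    and M :: "('k, 'a, 'm) left_dgmodule" +
  fixes N :: "('k, 'a, 'm) right_dgmodule"
  assumes mates: "koszul_mates A M N"
    and left_bilinear: "is_bilinear K M A M (\<lambda>x a. lact M a x)"
    and right_bilinear: "is_bilinear K M A M (ract N)"
    and left_degree: "\<lbrakk>a \<in> grade A q; x \<in> grade M p\<rbrakk> \<Longrightarrow> lact M a x \<in> grade M (q + p)"
begin

sublocale MA: graded_pair K M A M by unfold_locales

lemma same: "same_module M N" and grade_N [simp]: "grade N = grade M" and dif_N [simp]: "dif N = dif M"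
  using mates by (simp_all add: koszul_mates_def)

lemma carrier_N [simp]: "carrier N = carrier M" and add_N [simp]: "add N = add M"
  using same by (simp_all add: same_module_def)

lemma ksign_N [simp]: "ksign N n x = ksign M n x"
  by (rule ksign_same[OF same, symmetric])

lemma ract_eq: "\<lbrakk>x \<in> grade M p; a \<in> grade A q\<rbrakk> \<Longrightarrow> ract N x a = ksign M (p * q) (lact M a x)"
  using mates by (simp add: koszul_mates_def)

lemma lact_closed: "\<lbrakk>a \<in> carrier A; x \<in> carrier M\<rbrakk> \<Longrightarrow> lact M a x \<in> carrier M"
  by (rule bilinear_closed[OF left_bilinear])

lemma ract_closed: "\<lbrakk>x \<in> carrier M; a \<in> carrier A\<rbrakk> \<Longrightarrow> ract N x a \<in> carrier M"
  by (rule bilinear_closed[OF right_bilinear])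

lemma lact_eq:
  "\<lbrakk>x \<in> grade M p; a \<in> grade A q\<rbrakk> \<Longrightarrow> lact M a x = ksign M (p * q) (ract N x a)"
  using lact_closed[OF alg.grade_closed M.grade_closed]
  by (simp add: ract_eq M.ksign_ksign) (simp add: ksign_def)

lemma right_degree: "\<lbrakk>x \<in> grade M p; a \<in> grade A q\<rbrakk> \<Longrightarrow> ract N x a \<in> grade M (p + q)"
  using left_degree[of a q x p] by (simp add: ract_eq M.grade_ksign add.commute)

lemma ksign_cancel:
  "\<lbrakk>u \<in> carrier M; v \<in> carrier M\<rbrakk> \<Longrightarrow> ksign M n u = ksign M n v \<longleftrightarrow> u = v"
  unfolding ksign_def using M.minus_minus by metis

lemma lact_ksign: "\<lbrakk>a \<in> carrier A; x \<in> carrier M\<rbrakk> \<Longrightarrow> lact M a (ksign M n x) = ksign M n (lact M a x)"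
  using MA.LN.linear_ksign[OF bilinear_left[OF left_bilinear]] by simp

lemma ract_ksign: "\<lbrakk>a \<in> carrier A; x \<in> carrier M\<rbrakk> \<Longrightarrow> ract N x (ksign A n a) = ksign M n (ract N x a)"
  using MA.MN.linear_ksign[OF bilinear_right[OF right_bilinear]] by simp

lemma ract_op_mult:
  assumes x: "x \<in> grade M r" and a: "a \<in> grade A p" and b: "b \<in> grade A q"
  shows "ract N x (a \<otimes>\<^bsub>dg_op A\<^esub> b) = ksign M (p * q + r * (p + q)) (lact M (b \<otimes>\<^bsub>A\<^esub> a) x)"
proof -
  have ba: "b \<otimes>\<^bsub>A\<^esub> a \<in> grade A (p + q)"
    using alg.mult_degree[OF b a] by (simp add: add.commute)
  note c = M.grade_closed[OF x] alg.grade_closed[OF ba]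
  show ?thesis
    using c by (simp add: alg.op_mult_homogeneous[OF a b] ract_ksign ract_eq[OF x ba] M.ksign_ksign
        lact_closed)
qed

lemma ract_ract:
  assumes x: "x \<in> grade M r" and a: "a \<in> grade A p" and b: "b \<in> grade A q"
  shows "ract N (ract N x a) b = ksign M (p * q + r * (p + q)) (lact M b (lact M a x))"
proof -
  note c = M.grade_closed[OF x] alg.grade_closed[OF a] alg.grade_closed[OF b]
  have "ract N (ract N x a) b = ksign M ((r + p) * q) (ksign M (r * p) (lact M b (lact M a x)))"
    using c by (subst ract_eq[OF right_degree[OF x a] b])
      (simp add: ract_eq[OF x a] lact_ksign lact_closed)
  then show ?thesis
    using c by (simp add: M.ksign_ksign lact_closed algebra_simps)
qed

text \<open>
  Both \<open>x (a\<^sup>o b\<^sup>o)\<close> and \<open>(x a\<^sup>o) b\<^sup>o\<close> carry the sign with exponent \<open>|a||b| + |x|(|a| + |b|)\<close> relative to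
  \<open>(b a) x\<close> and \<open>b (a x)\<close>; the sign in the product of the opposite algebra is what makes the two agree.
\<close>
lemma assoc_homogeneous_iff:
  assumes "x \<in> grade M r" "a \<in> grade A p" "b \<in> grade A q"
  shows "ract N x (a \<otimes>\<^bsub>dg_op A\<^esub> b) = ract N (ract N x a) b
    \<longleftrightarrow> lact M (b \<otimes>\<^bsub>A\<^esub> a) x = lact M b (lact M a x)"
  using assms alg.grade_closed M.grade_closed
  by (simp add: ract_op_mult[OF assms] ract_ract[OF assms] ksign_cancel lact_closed
      bilinear_closed[OF alg.mult_bilinear])

lemma assoc_iff:
  "(\<forall>a\<in>carrier A. \<forall>b\<in>carrier A. \<forall>x\<in>carrier M. lact M (a \<otimes>\<^bsub>A\<^esub> b) x = lact M a (lact M b x)) \<longleftrightarrow>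
   (\<forall>x\<in>carrier M. \<forall>a\<in>carrier A. \<forall>b\<in>carrier A.
      ract N x (a \<otimes>\<^bsub>dg_op A\<^esub> b) = ract N (ract N x a) b)"
    (is "?left \<longleftrightarrow> ?right")
proof
  assume L: ?left
  show ?right
  proof (intro ballI)
    fix x a b assume *: "x \<in> carrier M" "a \<in> carrier A" "b \<in> carrier A"
    show "ract N x (a \<otimes>\<^bsub>dg_op A\<^esub> b) = ract N (ract N x a) b"
    proof (rule trilinear_eq_homogeneous[OF M.graded_module_axioms alg.graded_module_axioms
          alg.graded_module_axioms M.module_axioms _ _ _ _ _ _ _ *])
      fix r p q x a b assume h: "x \<in> grade M r" "a \<in> grade A p" "b \<in> grade A q"
      show "ract N x (a \<otimes>\<^bsub>dg_op A\<^esub> b) = ract N (ract N x a) b"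
        using L h alg.grade_closed M.grade_closed by (simp add: assoc_homogeneous_iff[OF h])
    qed (intro linear_compose[OF bilinear_right[OF right_bilinear]]
        linear_compose[OF bilinear_left[OF right_bilinear]] ract_closed
        bilinear_left[OF right_bilinear] bilinear_right[OF right_bilinear]
        bilinear_left[OF alg.op_mult_bilinear] bilinear_right[OF alg.op_mult_bilinear]
        bilinear_closed[OF alg.op_mult_bilinear]; assumption)+
  qed
next
  assume R: ?right
  show ?left
  proof (intro ballI)
    fix a b x assume *: "a \<in> carrier A" "b \<in> carrier A" "x \<in> carrier M"
    show "lact M (a \<otimes>\<^bsub>A\<^esub> b) x = lact M a (lact M b x)"
    proof (rule trilinear_eq_homogeneous[OF alg.graded_module_axioms alg.graded_module_axioms
          M.graded_module_axioms M.module_axioms _ _ _ _ _ _ _ *])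
      fix p q r a b x assume h: "a \<in> grade A p" "b \<in> grade A q" "x \<in> grade M r"
      show "lact M (a \<otimes>\<^bsub>A\<^esub> b) x = lact M a (lact M b x)"
        using R h alg.grade_closed M.grade_closed assoc_homogeneous_iff[OF h(3) h(2) h(1)] by blast
    qed (intro linear_compose[OF bilinear_right[OF left_bilinear]]
        linear_compose[OF bilinear_left[OF left_bilinear]] lact_closed
        bilinear_left[OF left_bilinear] bilinear_right[OF left_bilinear]
        bilinear_left[OF alg.mult_bilinear] bilinear_right[OF alg.mult_bilinear]
        bilinear_closed[OF alg.mult_bilinear]; assumption)+
  qed
qed

text \<open>
  The right-hand side of the Leibniz rule for the right action is \<open>(-1)\<^bsup>|x||a|\<^esup>\<close> times the one for the
  left action, with its two summands exchanged.
\<close>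
lemma leibniz_homogeneous_iff:
  assumes x: "x \<in> grade M r" and a: "a \<in> grade A p"
  shows "dif M (ract N x a) = ract N (dif M x) a \<oplus>\<^bsub>M\<^esub> ksign M r (ract N x (dif A a))
    \<longleftrightarrow> dif M (lact M a x) = lact M (dif A a) x \<oplus>\<^bsub>M\<^esub> ksign M p (lact M a (dif M x))"
proof -
  note dx = M.dif_degree[OF x] and da = alg.dif_degree[OF a]
  note c = M.grade_closed[OF x] alg.grade_closed[OF a] M.grade_closed[OF dx] alg.grade_closed[OF da]
  have cc: "lact M a x \<in> carrier M" "lact M (dif A a) x \<in> carrier M" "lact M a (dif M x) \<in> carrier M"
    using c lact_closed by auto
  have "dif M (ract N x a) = ksign M (r * p) (dif M (lact M a x))"
    using cc by (simp add: ract_eq[OF x a] MA.LN.linear_ksign[OF M.dif_linear])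
  moreover have "ract N (dif M x) a \<oplus>\<^bsub>M\<^esub> ksign M r (ract N x (dif A a)) =
      ksign M ((r + 1) * p) (lact M a (dif M x)) \<oplus>\<^bsub>M\<^esub> ksign M (r + r * (p + 1)) (lact M (dif A a) x)"
    using cc by (simp add: ract_eq[OF x da] ract_eq[OF dx a] M.ksign_ksign)
  moreover have "\<dots> = ksign M (r * p) (lact M (dif A a) x \<oplus>\<^bsub>M\<^esub> ksign M p (lact M a (dif M x)))"
  proof -
    have "ksign M (r + r * (p + 1)) (lact M (dif A a) x) = ksign M (r * p) (lact M (dif A a) x)"
      by (rule M.ksign_parity) auto
    moreover have "ksign M ((r + 1) * p) (lact M a (dif M x)) = ksign M (r * p + p) (lact M a (dif M x))"
      by (rule M.ksign_parity) (auto simp: algebra_simps)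
    ultimately show ?thesis
      using cc by (simp add: M.ksign_add M.ksign_ksign M.a_comm)
  qed
  ultimately show ?thesis
    using cc linear_closed[OF M.dif_linear] by (simp add: ksign_cancel)
qed

lemma leibniz_iff:
  "(\<forall>n. \<forall>a\<in>grade A n. \<forall>x\<in>carrier M.
      dif M (lact M a x) = lact M (dif A a) x \<oplus>\<^bsub>M\<^esub> ksign M n (lact M a (dif M x))) \<longleftrightarrow>
   (\<forall>n. \<forall>x\<in>grade M n. \<forall>a\<in>carrier A.
      dif M (ract N x a) = ract N (dif M x) a \<oplus>\<^bsub>M\<^esub> ksign M n (ract N x (dif A a)))"
    (is "?left \<longleftrightarrow> ?right")
proof
  assume L: ?left
  show ?right
  proof (intro allI ballI)
    fix n x a assume x: "x \<in> grade M n" and a: "a \<in> carrier A"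
    note xc = M.grade_closed[OF x]
    note dxc = linear_closed[OF M.dif_linear xc]
    show "dif M (ract N x a) = ract N (dif M x) a \<oplus>\<^bsub>M\<^esub> ksign M n (ract N x (dif A a))"
    proof (rule alg.linear_eq_homogeneous[OF _ _ M.module_axioms _ a])
      show "is_linear K A M (\<lambda>a. dif M (ract N x a))"
        by (rule linear_compose[OF M.dif_linear bilinear_right[OF right_bilinear xc]])
      show "is_linear K A M (\<lambda>a. ract N (dif M x) a \<oplus>\<^bsub>M\<^esub> ksign M n (ract N x (dif A a)))"
        by (intro MA.MN.is_linear_add MA.MN.is_linear_ksign bilinear_right[OF right_bilinear dxc]
            linear_compose[OF bilinear_right[OF right_bilinear xc] alg.dif_linear])
      show "dif M (ract N x a) = ract N (dif M x) a \<oplus>\<^bsub>M\<^esub> ksign M n (ract N x (dif A a))"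
        if a: "a \<in> grade A p" for p a
        using L a xc leibniz_homogeneous_iff[OF x a] by blast
    qed
  qed
next
  assume R: ?right
  show ?left
  proof (intro allI ballI)
    fix n a x assume a: "a \<in> grade A n" and x: "x \<in> carrier M"
    note ac = alg.grade_closed[OF a]
    note dac = linear_closed[OF alg.dif_linear ac]
    show "dif M (lact M a x) = lact M (dif A a) x \<oplus>\<^bsub>M\<^esub> ksign M n (lact M a (dif M x))"
    proof (rule M.linear_eq_homogeneous[OF _ _ M.module_axioms _ x])
      show "is_linear K M M (\<lambda>x. dif M (lact M a x))"
        by (rule linear_compose[OF M.dif_linear bilinear_left[OF left_bilinear ac]])
      show "is_linear K M M (\<lambda>x. lact M (dif A a) x \<oplus>\<^bsub>M\<^esub> ksign M n (lact M a (dif M x)))"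
        by (intro MA.LN.is_linear_add MA.LN.is_linear_ksign bilinear_left[OF left_bilinear dac]
            linear_compose[OF bilinear_left[OF left_bilinear ac] M.dif_linear])
      show "dif M (lact M a x) = lact M (dif A a) x \<oplus>\<^bsub>M\<^esub> ksign M n (lact M a (dif M x))"
        if x: "x \<in> grade M p" for p x
        using R x ac leibniz_homogeneous_iff[OF x a] by blast
    qed
  qed
qed

lemma unitary_iff:
  "generate (add_monoid M) {lact M a x | a x. a \<in> carrier A \<and> x \<in> carrier M} =
   generate (add_monoid M) {ract N x a | x a. x \<in> carrier M \<and> a \<in> carrier A}"
proof -
  have "{lact M a x | a x. a \<in> carrier A \<and> x \<in> carrier M} =
      {lact M a x | x a. x \<in> carrier M \<and> a \<in> carrier A}"
    by blast
  then show ?thesis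
    using MA.generate_twisted[OF left_bilinear right_bilinear ract_eq]
      MA.generate_twisted[OF right_bilinear left_bilinear lact_eq] by auto
qed

lemma left_iff_right: "left_dg_module K A M \<longleftrightarrow> right_dg_module K (dg_op A) N"
proof -
  have N: "dg_module K N"
    by (rule dg_module_same[OF same _ _ M.dg_module_axioms]) simp_all
  interpret N: dg_module K N by (rule N)
  have lb: "is_bilinear K A M M (lact M)" by (rule is_bilinear_flip[OF left_bilinear])
  have rb: "is_bilinear K N (dg_op A) N (ract N)"
    using right_bilinear is_bilinear_same[where K = K, OF same same_module_dg_op[of A] same] by simp
  have left: "left_dg_module K A M \<longleftrightarrow>
      (\<forall>a\<in>carrier A. \<forall>b\<in>carrier A. \<forall>x\<in>carrier M. lact M (a \<otimes>\<^bsub>A\<^esub> b) x = lact M a (lact M b x)) \<and>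
      generate (add_monoid M) {lact M a x | a x. a \<in> carrier A \<and> x \<in> carrier M} = carrier M \<and>
      (\<forall>n. \<forall>a\<in>grade A n. \<forall>x\<in>carrier M.
        dif M (lact M a x) = lact M (dif A a) x \<oplus>\<^bsub>M\<^esub> ksign M n (lact M a (dif M x)))"
    using lb left_degree M.dg_module_axioms M.graded_module_axioms
    by (auto simp: left_dg_module_def graded_left_module_def graded_left_module_axioms_def
        left_dg_module_axioms_def)
  have right: "right_dg_module K (dg_op A) N \<longleftrightarrow>
      (\<forall>x\<in>carrier M. \<forall>a\<in>carrier A. \<forall>b\<in>carrier A.
        ract N x (a \<otimes>\<^bsub>dg_op A\<^esub> b) = ract N (ract N x a) b) \<and>
      generate (add_monoid M) {ract N x a | x a. x \<in> carrier M \<and> a \<in> carrier A} = carrier M \<and>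
      (\<forall>n. \<forall>x\<in>grade M n. \<forall>a\<in>carrier A.
        dif M (ract N x a) = ract N (dif M x) a \<oplus>\<^bsub>M\<^esub> ksign M n (ract N x (dif A a)))"
    using rb right_degree N.dg_module_axioms N.graded_module_axioms
    by (auto simp: right_dg_module_def graded_right_module_def graded_right_module_axioms_def
        right_dg_module_axioms_def generate_same[OF same])
  show ?thesis
    unfolding left right assoc_iff leibniz_iff unitary_iff ..
qed

end

lemma (in dg_algebra_enough_idempotents) left_has_mate:
  fixes M :: "('k, 'a, 'm) left_dgmodule"
  assumes "left_dg_module K A M"
  shows "\<exists>N. mate_actions K A I e M N"
proof -
  interpret M: left_dg_module K A M by fact
  interpret MA: graded_pair K M A M by unfold_locales
  have bil: "is_bilinear K M A M (\<lambda>x a. lact M a x)" by (rule is_bilinear_flip[OF M.lact_bilinear])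
  define N :: "('k, 'a, 'm) right_dgmodule" where
    "N = \<lparr>carrier = carrier M, mult = mult M, one = one M, zero = zero M, add = add M,
      smult = smult M, grade = grade M, dif = dif M, ract = ktwist M A M (\<lambda>x a. lact M a x)\<rparr>"
  have "mate_actions K A I e M N"
  proof unfold_locales
    show "koszul_mates A M N"
      by (auto simp: koszul_mates_def same_module_def N_def MA.ktwist_homogeneous[OF bil])
    show "is_bilinear K M A M (ract N)"
      by (simp add: N_def MA.ktwist_bilinear[OF bil])
  qed (use bil M.lact_degree in auto)
  then show ?thesis ..
qed

text \<open>
  Twisting twice gives back the original action, so the same recipe produces a left module from a
  right one.
\<close>
lemma (in dg_algebra_enough_idempotents) right_has_mate:
  fixes N :: "('k, 'a, 'm) right_dgmodule"
  assumes "right_dg_module K (dg_op A) N"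
  shows "\<exists>M. mate_actions K A I e M N"
proof -
  interpret N: right_dg_module K "dg_op A" N by fact
  interpret NA: graded_pair K N A N by unfold_locales
  have bil: "is_bilinear K N A N (ract N)"
    using N.ract_bilinear is_bilinear_same[where K = K, OF same_module_refl[of N] same_module_dg_op[of A] same_module_refl[of N]]
    by simp
  define M :: "('k, 'a, 'm) left_dgmodule" where
    "M = \<lparr>carrier = carrier N, mult = mult N, one = one N, zero = zero N, add = add N,
      smult = smult N, grade = grade N, dif = dif N, lact = (\<lambda>a x. ktwist N A N (ract N) x a)\<rparr>"
  have same: "same_module N M" "same_module M N" by (simp_all add: same_module_def M_def)
  have gr: "grade M = grade N" "dif M = dif N" by (simp_all add: M_def)
  have lact: "lact M a x = ksign N (p * q) (ract N x a)" if "x \<in> grade N p" "a \<in> grade A q" for a x p q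
    by (simp add: M_def NA.ktwist_homogeneous[OF bil that])
  interpret M: dg_module K M
    by (rule dg_module_same[OF same(1) _ _ N.dg_module_axioms]) (simp_all add: gr)
  have "mate_actions K A I e M N"
  proof unfold_locales
    have "ract N x a = ksign M (p * q) (lact M a x)" if "x \<in> grade N p" "a \<in> grade A q" for a x p q
      using bilinear_closed[OF bil N.grade_closed[OF that(1)] grade_closed[OF that(2)]]
      by (simp add: lact[OF that] ksign_same[OF same(2)] N.ksign_ksign) (simp add: ksign_def)
    then show "koszul_mates A M N"
      using same gr by (simp add: koszul_mates_def)
    show "is_bilinear K M A M (ract N)"
      using bil is_bilinear_same[where K = K, OF same(2) same_module_refl[of A] same(2)] by simp
    have "is_bilinear K N A N (\<lambda>x a. lact M a x)"
      using NA.ktwist_bilinear[OF bil] by (simp add: M_def)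
    then show "is_bilinear K M A M (\<lambda>x a. lact M a x)"
      using is_bilinear_same[where K = K, OF same(2) same_module_refl[of A] same(2)] by simp
    show "lact M a x \<in> grade M (q + p)" if "a \<in> grade A q" "x \<in> grade M p" for a x p q
      using that N.ract_degree[of x p a q] by (simp add: gr lact N.grade_ksign add.commute)
  qed
  then show ?thesis ..
qed

section \<open>The dg category of left dg modules\<close>

context dg_algebra_enough_idempotents
begin

text \<open>
  The only point that needs a computation is that \<open>D f = d \<circ> f - (-1)\<^sup>n f \<circ> d\<close> is again sign-linear over \<open>A\<close>,
  of degree \<open>n + 1\<close>.  Expanding \<open>D f (a x)\<close> by the Leibniz rules, the two terms with \<open>d a\<close> have the
  same sign and cancel; the others acquire \<open>(-1)\<^bsup>(n + 1)|a|\<^esup>\<close>.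
\<close>
lemma left_hom_family:
  assumes "left_dg_module K A M" "left_dg_module K A N"
  shows "hom_family K M N (left_hom K A M N)"
proof -
  interpret M: left_dg_module K A M by fact
  interpret N: left_dg_module K A N by fact
  interpret MN: two_modules K M N by unfold_locales
  interpret NN: two_modules K N N by unfold_locales
  note lin = bilinear_right[OF N.lact_bilinear]
  show ?thesis
  proof unfold_locales
    fix f n assume f: "f \<in> left_hom K A M N n"
    then show "f \<in> extensional (carrier M)" and fl: "is_linear K M N f"
      by (auto simp: left_hom_def PiE_def)
    show "f x \<in> grade N (p + n)" if "x \<in> grade M p" for x p
      using f that by (auto simp: left_hom_def)
    then have fdeg: "f x \<in> grade N (p + n)" if "x \<in> grade M p" for x p
      using that .
    have fa: "f (lact M a x) = ksign N (n * p) (lact N a (f x))"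
      if "a \<in> grade A p" "x \<in> carrier M" for a x p
      using f that by (auto simp: left_hom_def)
    note fc = linear_closed[OF fl] and dM = linear_closed[OF M.dif_linear]
      and dN = linear_closed[OF N.dif_linear]
    let ?D = "\<lambda>x. dif N (f x) \<ominus>\<^bsub>N\<^esub> ksign N n (f (dif M x))"
    have Dl: "is_linear K M N ?D"
      by (intro MN.is_linear_diff MN.is_linear_ksign linear_compose[OF N.dif_linear fl]
          linear_compose[OF fl M.dif_linear])
    show "restrict ?D (carrier M) \<in> left_hom K A M N (n + 1)"
      unfolding left_hom_def
    proof (intro CollectI conjI allI ballI)
      show "restrict ?D (carrier M) \<in> carrier M \<rightarrow>\<^sub>E carrier N"
        using linear_closed[OF Dl] by auto
      show "is_linear K M N (restrict ?D (carrier M))"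
        by (rule linear_cong[OF Dl M.module_axioms]) simp
      show "restrict ?D (carrier M) x \<in> grade N (p + (n + 1))" if x: "x \<in> grade M p" for p x
        using N.dif_degree[OF fdeg[OF x]] fdeg[OF M.dif_degree[OF x]] M.grade_closed[OF x]
        by (simp add: N.grade_diff N.grade_ksign algebra_simps)
      fix p a x assume a: "a \<in> grade A p" and x: "x \<in> carrier M"
      note ac = grade_closed[OF a] and dac = grade_closed[OF dif_degree[OF a]]
      note lc = bilinear_closed[OF N.lact_bilinear] and lcM = bilinear_closed[OF M.lact_bilinear]
      have c: "lact N (dif A a) (f x) \<in> carrier N" "lact N a (dif N (f x)) \<in> carrier N"
        "lact N a (f (dif M x)) \<in> carrier N" "lact N a (f x) \<in> carrier N"
        "f (dif M x) \<in> carrier N" "dif N (f x) \<in> carrier N"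
        "lact M a x \<in> carrier M" "lact M a (dif M x) \<in> carrier M" "lact M (dif A a) x \<in> carrier M"
        using x ac dac fc dM dN lc lcM by auto
      (* First summand of D f (a x): apply sign-linearity of f, then the Leibniz rule in N. *)
      have s1: "dif N (f (lact M a x)) =
          ksign N (n * p) (lact N (dif A a) (f x)) \<oplus>\<^bsub>N\<^esub> ksign N (n * p + p) (lact N a (dif N (f x)))"
        using c by (simp add: fa[OF a x] NN.linear_ksign[OF N.dif_linear] N.lact_leibniz[OF a fc[OF x]]
            N.ksign_add N.ksign_ksign)
      (* Second summand: the Leibniz rule in M comes first, and f passes d a, of degree p + 1;
         the exponent n + n (p + 1) has the parity of n p. *)
      have s2: "ksign N n (f (dif M (lact M a x))) =
          ksign N (n * p) (lact N (dif A a) (f x)) \<oplus>\<^bsub>N\<^esub>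
          ksign N (n * p + p + n) (lact N a (f (dif M x)))"
      proof -
        have "ksign N n (f (dif M (lact M a x))) =
            ksign N (n + n * (p + 1)) (lact N (dif A a) (f x)) \<oplus>\<^bsub>N\<^esub>
            ksign N (n + (p + n * p)) (lact N a (f (dif M x)))"
          using c by (simp add: M.lact_leibniz[OF a x] linear_add[OF fl] MN.linear_ksign[OF fl]
              fa[OF a dM[OF x]] fa[OF dif_degree[OF a] x] N.ksign_add N.ksign_ksign)
        moreover have "ksign N (n + n * (p + 1)) (lact N (dif A a) (f x)) =
            ksign N (n * p) (lact N (dif A a) (f x))"
          by (rule N.ksign_parity) auto
        ultimately show ?thesis by (simp add: algebra_simps)
      qed
      have s3: "ksign N ((n + 1) * p) (lact N a (?D x)) =
          ksign N (n * p + p) (lact N a (dif N (f x))) \<ominus>\<^bsub>N\<^esub>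
          ksign N (n * p + p + n) (lact N a (f (dif M x)))"
      proof -
        have "lact N a (?D x) = lact N a (dif N (f x)) \<ominus>\<^bsub>N\<^esub> ksign N n (lact N a (f (dif M x)))"
          using c by (simp add: NN.linear_diff[OF lin[OF ac]] NN.linear_ksign[OF lin[OF ac]])
        then show ?thesis
          using c by (simp add: N.minus_eq N.ksign_add N.minus_ksign N.ksign_ksign algebra_simps)
      qed
      have canc: "(u \<oplus>\<^bsub>N\<^esub> v) \<ominus>\<^bsub>N\<^esub> (u \<oplus>\<^bsub>N\<^esub> w) = v \<ominus>\<^bsub>N\<^esub> w"
        if "u \<in> carrier N" "v \<in> carrier N" "w \<in> carrier N" for u v w
      proof -
        have "(u \<oplus>\<^bsub>N\<^esub> v) \<ominus>\<^bsub>N\<^esub> (u \<oplus>\<^bsub>N\<^esub> w) = u \<oplus>\<^bsub>N\<^esub> (\<ominus>\<^bsub>N\<^esub> u \<oplus>\<^bsub>N\<^esub> (v \<ominus>\<^bsub>N\<^esub> w))"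
          using that by (simp add: N.minus_eq N.minus_add N.a_ac)
        then show ?thesis using that by (simp add: N.r_neg2)
      qed
      show "restrict ?D (carrier M) (lact M a x) =
          ksign N ((n + 1) * p) (lact N a (restrict ?D (carrier M) x))"
        using c x by (simp add: s1 s2 s3 canc)
    qed
  next
    fix n
    show "(\<lambda>x\<in>carrier M. \<zero>\<^bsub>N\<^esub>) \<in> left_hom K A M N n"
      using bilinear_closed[OF M.lact_bilinear] grade_closed M.grade_closed
      by (auto simp: left_hom_def N.grade_zero NN.linear_zero[OF lin]
          intro!: linear_cong[OF MN.is_linear_zero_map M.module_axioms])
  next
    fix f g n assume f: "f \<in> left_hom K A M N n" and g: "g \<in> left_hom K A M N n"
    have fl: "is_linear K M N f" and gl: "is_linear K M N g"
      using f g by (auto simp: left_hom_def)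
    have "lact N a (f x) \<oplus>\<^bsub>N\<^esub> lact N a (g x) = lact N a (f x \<oplus>\<^bsub>N\<^esub> g x)"
      if "a \<in> carrier A" "x \<in> carrier M" for a x
      using linear_add[OF lin[OF that(1)]] linear_closed[OF fl that(2)] linear_closed[OF gl that(2)]
      by simp
    then show "(\<lambda>x\<in>carrier M. f x \<oplus>\<^bsub>N\<^esub> g x) \<in> left_hom K A M N n"
      using f g bilinear_closed[OF M.lact_bilinear] bilinear_closed[OF N.lact_bilinear]
        grade_closed M.grade_closed linear_closed[OF fl] linear_closed[OF gl]
      by (auto simp: left_hom_def N.grade_add N.ksign_add[symmetric]
          intro!: linear_cong[OF MN.is_linear_add[OF fl gl] M.module_axioms])
  next
    fix f k n assume k: "k \<in> carrier K" and f: "f \<in> left_hom K A M N n"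
    have fl: "is_linear K M N f" using f by (auto simp: left_hom_def)
    have "k \<odot>\<^bsub>N\<^esub> ksign N m (lact N a (f x)) = ksign N m (lact N a (k \<odot>\<^bsub>N\<^esub> f x))"
      if "a \<in> carrier A" "x \<in> carrier M" for a x m
      using linear_smult[OF lin[OF that(1)] k] linear_closed[OF fl that(2)]
        NN.linear_ksign[OF N.is_linear_smult[OF k]] linear_closed[OF lin[OF that(1)]]
      by simp
    then show "(\<lambda>x\<in>carrier M. k \<odot>\<^bsub>N\<^esub> f x) \<in> left_hom K A M N n"
      using f k bilinear_closed[OF M.lact_bilinear] grade_closed M.grade_closed linear_closed[OF fl]
      by (auto simp: left_hom_def N.grade_smult
          intro!: linear_cong[OF linear_compose[OF N.is_linear_smult[OF k] fl] M.module_axioms])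
  qed
qed

lemma left_hom_compose:
  assumes "left_dg_module K A L" "left_dg_module K A M" "left_dg_module K A N"
    and g: "g \<in> left_hom K A M N m" and f: "f \<in> left_hom K A L M n"
  shows "compose (carrier L) g f \<in> left_hom K A L N (m + n)"
proof -
  interpret L: left_dg_module K A L by fact
  interpret M: left_dg_module K A M by fact
  interpret N: left_dg_module K A N by fact
  interpret MN: two_modules K M N by unfold_locales
  have fl: "is_linear K L M f" and gl: "is_linear K M N g" using f g by (auto simp: left_hom_def)
  show ?thesis
    unfolding left_hom_def
  proof (intro CollectI conjI allI ballI)
    show "compose (carrier L) g f \<in> carrier L \<rightarrow>\<^sub>E carrier N"
      using linear_closed[OF fl] linear_closed[OF gl] by (auto simp: compose_def)
    show "is_linear K L N (compose (carrier L) g f)"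
      by (rule linear_cong[OF linear_compose[OF gl fl] L.module_axioms]) (simp add: compose_eq)
    show "compose (carrier L) g f x \<in> grade N (p + (m + n))" if x: "x \<in> grade L p" for p x
    proof -
      have "f x \<in> grade M (p + n)" using f x by (auto simp: left_hom_def)
      then have "g (f x) \<in> grade N (p + n + m)" using g by (auto simp: left_hom_def)
      then show ?thesis using L.grade_closed[OF x] by (simp add: compose_eq algebra_simps)
    qed
    fix p a x assume a: "a \<in> grade A p" and x: "x \<in> carrier L"
    note ac = grade_closed[OF a]
    have fx: "f x \<in> carrier M" by (rule linear_closed[OF fl x])
    have "f (lact L a x) = ksign M (n * p) (lact M a (f x))"
      using f a x by (auto simp: left_hom_def)
    moreover have "g (lact M a (f x)) = ksign N (m * p) (lact N a (g (f x)))"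
      using g a fx by (auto simp: left_hom_def)
    ultimately have "g (f (lact L a x)) = ksign N (n * p + m * p) (lact N a (g (f x)))"
      using bilinear_closed[OF M.lact_bilinear ac fx]
        bilinear_closed[OF N.lact_bilinear ac linear_closed[OF gl fx]]
      by (simp add: MN.linear_ksign[OF gl] N.ksign_ksign)
    then show "compose (carrier L) g f (lact L a x) =
        ksign N ((m + n) * p) (lact N a (compose (carrier L) g f x))"
      using x bilinear_closed[OF L.lact_bilinear ac x] by (simp add: compose_eq algebra_simps)
  qed
qed

lemma left_hom_ident:
  assumes "left_dg_module K A M"
  shows "(\<lambda>x\<in>carrier M. x) \<in> left_hom K A M M 0"
proof -
  interpret M: left_dg_module K A M by fact
  show ?thesis
    using bilinear_closed[OF M.lact_bilinear] grade_closed M.grade_closed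
    by (auto simp: left_hom_def ksign_def intro!: linear_cong[OF M.is_linear_id M.module_axioms])
qed

lemma left_hom_composition:
  assumes "left_dg_module K A L" "left_dg_module K A M" "left_dg_module K A N"
  shows "hom_composition K L M N (left_hom K A L M) (left_hom K A M N) (left_hom K A L N)"
  by (intro hom_composition.intro left_hom_family hom_composition_axioms.intro
      left_hom_compose[OF assms] assms)

lemma left_Dg_category:
  "dg_category K (left_Dg K A :: (('k, 'a, 'm) left_dgmodule, 'k, 'm \<Rightarrow> 'm) dgcat)"
proof (rule dg_category.intro, unfold left_Dg_def dgcat.simps mem_Collect_eq)
  fix X Y :: "('k, 'a, 'm) left_dgmodule"
  assume "left_dg_module K A X" "left_dg_module K A Y"
  then show "dg_module K (dg_hom X Y (left_hom K A X Y))"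
    by (intro hom_family.hom_dg_module left_hom_family)
next
  fix X Y Z :: "('k, 'a, 'm) left_dgmodule"
  assume "left_dg_module K A X" "left_dg_module K A Y" "left_dg_module K A Z"
  then interpret C: hom_composition K X Y Z "left_hom K A X Y" "left_hom K A Y Z" "left_hom K A X Z"
    by (rule left_hom_composition)
  show "is_bilinear K (dg_hom Y Z (left_hom K A Y Z)) (dg_hom X Y (left_hom K A X Y))
      (dg_hom X Z (left_hom K A X Z)) (compose (carrier X))"
    by (rule C.compose_bilinear)
  show "compose (carrier X) g f \<in> grade (dg_hom X Z (left_hom K A X Z)) (m + n)"
    if "g \<in> grade (dg_hom Y Z (left_hom K A Y Z)) m" "f \<in> grade (dg_hom X Y (left_hom K A X Y)) n"
    for g f m n
    using that C.compose_degree by (simp add: dg_hom_simps)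
  show "dif (dg_hom X Z (left_hom K A X Z)) (compose (carrier X) g f) =
      compose (carrier X) (dif (dg_hom Y Z (left_hom K A Y Z)) g) f
      \<oplus>\<^bsub>dg_hom X Z (left_hom K A X Z)\<^esub> ksign (dg_hom X Z (left_hom K A X Z)) m
        (compose (carrier X) g (dif (dg_hom X Y (left_hom K A X Y)) f))"
    if "g \<in> grade (dg_hom Y Z (left_hom K A Y Z)) m" "f \<in> carrier (dg_hom X Y (left_hom K A X Y))"
    for g f m
    using C.compose_leibniz[OF _ that(2), of g m] that(1) by (simp add: dg_hom_simps(5,6))
next
  fix W X Y Z :: "('k, 'a, 'm) left_dgmodule" and f g h :: "'m \<Rightarrow> 'm"
  assume "left_dg_module K A W" "left_dg_module K A X" "left_dg_module K A Y" "left_dg_module K A Z"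
    and f: "f \<in> carrier (dg_hom W X (left_hom K A W X))"
  then interpret WX: hom_family K W X "left_hom K A W X" by (intro left_hom_family)
  show "compose (carrier W) (compose (carrier X) h g) f =
      compose (carrier W) h (compose (carrier W) g f)"
    using WX.hom_apply_closed[OF f] by (auto simp: compose_def)
next
  fix X :: "('k, 'a, 'm) left_dgmodule"
  assume X: "left_dg_module K A X"
  then interpret XX: hom_family K X X "left_hom K A X X" by (intro left_hom_family)
  show "(\<lambda>x\<in>carrier X. x) \<in> carrier (dg_hom X X (left_hom K A X X))"
    by (rule XX.homogeneous_in_hom[OF left_hom_ident[OF X]])
next
  fix X Y :: "('k, 'a, 'm) left_dgmodule" and f :: "'m \<Rightarrow> 'm"
  assume "left_dg_module K A X" "left_dg_module K A Y" and f: "f \<in> carrier (dg_hom X Y (left_hom K A X Y))"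
  then interpret XY: hom_family K X Y "left_hom K A X Y" by (intro left_hom_family)
  show "compose (carrier X) (\<lambda>x\<in>carrier Y. x) f = f"
    by (rule extensionalityI[OF _ XY.hom_extensional[OF f]]) (auto simp: compose_eq XY.hom_apply_closed[OF f])
  show "compose (carrier X) f (\<lambda>x\<in>carrier X. x) = f"
    by (rule extensionalityI[OF _ XY.hom_extensional[OF f]]) (auto simp: compose_eq)
qed

end

section \<open>Comparison of the two categories\<close>

text \<open>
  The axioms of a dg category are statements about the morphism complexes of tuples of objects, hence
  they can be pulled back along any map on objects.  This yields the category of right modules from
  the one of left modules without a second verification of the axioms.
\<close>
lemma dg_category_pullback:
  assumes C: "dg_category K C"
    and G: "\<And>X. X \<in> obj D \<Longrightarrow> G X \<in> obj C"
    and Hom: "\<And>X Y. \<lbrakk>X \<in> obj D; Y \<in> obj D\<rbrakk> \<Longrightarrow> Hom D X Y = Hom C (G X) (G Y)"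
    and cmp: "\<And>X Y Z. \<lbrakk>X \<in> obj D; Y \<in> obj D; Z \<in> obj D\<rbrakk> \<Longrightarrow> cmp D X Y Z = cmp C (G X) (G Y) (G Z)"
    and ident: "\<And>X. X \<in> obj D \<Longrightarrow> ident D X = ident C (G X)"
  shows "dg_category K D"
proof -
  interpret C: dg_category K C by fact
  show ?thesis
    by (rule dg_category.intro)
      (simp_all add: G Hom cmp ident C.Hom_dg_module C.cmp_bilinear C.cmp_assoc C.ident_in
        C.ident_left C.ident_right C.cmp_degree C.cmp_leibniz)
qed

lemma dg_hom_same:
  assumes "same_module M M'" "grade M = grade M'" "dif M = dif M'"
    and "same_module N N'" "grade N = grade N'" "dif N = dif N'"
  shows "dg_hom M N H = dg_hom M' N' H"
proof -
  have "carrier M = carrier M'" "zero N = zero N'" "add N = add N'" "smult N = smult N'"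
    using assms(1,4) by (auto simp: same_module_def)
  then have g: "graded_hom M N H = graded_hom M' N' H"
    by (simp add: graded_hom_def finsum_same[OF assms(4)])
  then have "hom_dif M N H = hom_dif M' N' H"
    using \<open>carrier M = carrier M'\<close>
    by (simp add: hom_dif_def fun_eq_iff finsum_same[OF assms(4)] ksign_same[OF assms(4)]
        a_minus_same[OF assms(4)] assms(3,6))
  with g show ?thesis by (simp add: dg_hom_def)
qed

context dg_algebra_enough_idempotents
begin

text \<open>
  For \<open>f\<close> of degree \<open>n\<close> and homogeneous \<open>x\<close>, \<open>a\<close> one has \<open>f (x a\<^sup>o) = (-1)\<^bsup>|x||a|\<^esup> f (a x)\<close> and
  \<open>(f x) a\<^sup>o = (-1)\<^bsup>(|x| + n)|a|\<^esup> a (f x)\<close>, since \<open>f x\<close> has degree \<open>|x| + n\<close>.  So strict linearity for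
  the right actions is linearity up to \<open>(-1)\<^bsup>n|a|\<^esup>\<close> for the left actions.
\<close>
lemma left_hom_eq_right_hom:
  assumes "mate_actions K A I e M N" "mate_actions K A I e M' N'"
  shows "left_hom K A M M' n = right_hom K (dg_op A) N N' n"
proof -
  interpret M: mate_actions K A I e M N by fact
  interpret M': mate_actions K A I e M' N' by fact
  interpret MM: two_modules K M M' by unfold_locales
  have lin: "is_linear K N N' f \<longleftrightarrow> is_linear K M M' f" for f
    using is_linear_same[where K = K, OF M.same M'.same] by simp
  have act: "(\<forall>p. \<forall>a\<in>grade A p. \<forall>x\<in>carrier M. f (lact M a x) = ksign M' (n * p) (lact M' a (f x)))
      \<longleftrightarrow> (\<forall>x\<in>carrier M. \<forall>a\<in>carrier A. f (ract N x a) = ract N' (f x) a)"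
    (is "?left \<longleftrightarrow> ?right")
    if fl: "is_linear K M M' f" and fd: "\<And>p x. x \<in> grade M p \<Longrightarrow> f x \<in> grade M' (p + n)" for f
  proof -
    have fc: "f x \<in> carrier M'" if "x \<in> carrier M" for x by (rule linear_closed[OF fl that])
    have hom: "f (lact M a x) = ksign M' (n * q) (lact M' a (f x)) \<longleftrightarrow>
        f (ract N x a) = ract N' (f x) a" if x: "x \<in> grade M p" and a: "a \<in> grade A q" for x a p q
    proof -
      note c = M.lact_closed[OF grade_closed[OF a] M.M.grade_closed[OF x]]
        M'.lact_closed[OF grade_closed[OF a] fc[OF M.M.grade_closed[OF x]]]
      have "f (ract N x a) = ksign M' (p * q) (f (lact M a x))"
        using c by (simp add: M.ract_eq[OF x a] MM.linear_ksign[OF fl])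
      moreover have "ract N' (f x) a = ksign M' (p * q) (ksign M' (n * q) (lact M' a (f x)))"
        using c by (simp add: M'.ract_eq[OF fd[OF x] a] M'.M.ksign_ksign algebra_simps)
      ultimately show ?thesis
        using c fc by (simp add: M'.ksign_cancel)
    qed
    show ?thesis
    proof
      assume L: ?left
      show ?right
      proof (intro ballI)
        fix x a assume x: "x \<in> carrier M" and a: "a \<in> carrier A"
        interpret P: graded_pair K M A M' by unfold_locales
        show "f (ract N x a) = ract N' (f x) a"
        proof (rule P.bilinear_eq_homogeneous[OF _ _ _ x a])
          show "is_bilinear K M A M' (\<lambda>x a. f (ract N x a))"
            unfolding is_bilinear_def
            by (intro conjI ballI linear_compose[OF fl] bilinear_left[OF M.right_bilinear]
                bilinear_right[OF M.right_bilinear])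
          show "is_bilinear K M A M' (\<lambda>x a. ract N' (f x) a)"
            unfolding is_bilinear_def
            by (intro conjI ballI linear_compose[OF bilinear_left[OF M'.right_bilinear] fl]
                bilinear_right[OF M'.right_bilinear] fc)
          show "f (ract N x a) = ract N' (f x) a" if "x \<in> grade M p" "a \<in> grade A q" for p q x a
            using L that M.M.grade_closed hom[OF that] by blast
        qed
      qed
    next
      assume R: ?right
      show ?left
      proof (intro allI ballI)
        fix p a x assume a: "a \<in> grade A p" and x: "x \<in> carrier M"
        note ac = grade_closed[OF a]
        show "f (lact M a x) = ksign M' (n * p) (lact M' a (f x))"
        proof (rule M.M.linear_eq_homogeneous[OF _ _ M'.M.module_axioms _ x])
          show "is_linear K M M' (\<lambda>x. f (lact M a x))"
            by (rule linear_compose[OF fl bilinear_left[OF M.left_bilinear ac]])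
          show "is_linear K M M' (\<lambda>x. ksign M' (n * p) (lact M' a (f x)))"
            by (rule MM.is_linear_ksign[OF linear_compose[OF bilinear_left[OF M'.left_bilinear ac] fl]])
          show "f (lact M a x) = ksign M' (n * p) (lact M' a (f x))" if x: "x \<in> grade M r" for r x
            using R M.M.grade_closed[OF x] ac hom[OF x a] by blast
        qed
      qed
    qed
  qed
  show ?thesis
    unfolding left_hom_def right_hom_def
    by (rule Collect_cong, rule conj_cong, simp, rule conj_cong, simp add: lin, rule conj_cong, simp)
      (simp add: act lin)
qed

lemma dg_hom_mates:
  assumes "mate_actions K A I e M N" "mate_actions K A I e M' N'"
  shows "dg_hom N N' (right_hom K (dg_op A) N N') = dg_hom M M' (left_hom K A M M')"
proof -
  interpret M: mate_actions K A I e M N by fact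
  interpret M': mate_actions K A I e M' N' by fact
  have "left_hom K A M M' = right_hom K (dg_op A) N N'"
    using left_hom_eq_right_hom[OF assms] by (rule ext)
  then show ?thesis
    using dg_hom_same[OF M.same M.grade_N[symmetric] M.dif_N[symmetric]
        M'.same M'.grade_N[symmetric] M'.dif_N[symmetric]] by simp
qed

text \<open>
  The functor sends a left module to a mate and every morphism to itself; it is fully faithful because
  the morphism complexes coincide.  A right module and the image of its left mate have equal underlying
  dg modules and equal actions on homogeneous elements, but as records they may differ, for instance
  in the values of the action off the carriers.  So the functor is dense, with the identity map as the
  isomorphism, rather than surjective on objects.
\<close>
lemma left_right_equivalent:
  fixes C :: "(('k, 'a, 'm) left_dgmodule, 'k, 'm \<Rightarrow> 'm) dgcat"
    and D :: "(('k, 'a, 'm) right_dgmodule, 'k, 'm \<Rightarrow> 'm) dgcat"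
  defines "C \<equiv> left_Dg K A" and "D \<equiv> right_Dg K (dg_op A)"
  shows "dg_equivalent K C D"
proof -
  define F :: "('k, 'a, 'm) left_dgmodule \<Rightarrow> ('k, 'a, 'm) right_dgmodule"
    where "F M = (SOME N. mate_actions K A I e M N)" for M
  define G :: "('k, 'a, 'm) right_dgmodule \<Rightarrow> ('k, 'a, 'm) left_dgmodule"
    where "G N = (SOME M. mate_actions K A I e M N)" for N
  have F: "mate_actions K A I e M (F M)" if "M \<in> obj C" for M
  proof -
    have "\<exists>N. mate_actions K A I e M N"
      using left_has_mate[of M] that by (simp add: C_def left_Dg_def)
    then show ?thesis unfolding F_def by (rule someI_ex)
  qed
  have G: "mate_actions K A I e (G N) N" if "N \<in> obj D" for N
  proof -
    have "\<exists>M. mate_actions K A I e M N"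
      using right_has_mate[of N] that by (simp add: D_def right_Dg_def)
    then show ?thesis unfolding G_def by (rule someI_ex)
  qed
  have mate_obj: "M \<in> obj C \<longleftrightarrow> N \<in> obj D" if "mate_actions K A I e M N" for M N
    using mate_actions.left_iff_right[OF that] by (simp add: C_def D_def left_Dg_def right_Dg_def)
  have mate_Hom: "Hom D N N' = Hom C M M'"
    if "mate_actions K A I e M N" "mate_actions K A I e M' N'" for M M' N N'
    using dg_hom_mates[OF that] by (simp add: C_def D_def left_Dg_def right_Dg_def)
  have mate_cmp: "cmp D N Y Z = cmp C M Y' Z'" and mate_ident: "ident D N = ident C M"
    if "mate_actions K A I e M N" for M N Y Z Y' Z'
  proof -
    interpret mate_actions K A I e M N by (rule that)
    show "cmp D N Y Z = cmp C M Y' Z'" "ident D N = ident C M"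
      by (simp_all add: C_def D_def left_Dg_def right_Dg_def)
  qed
  have catC: "dg_category K C" unfolding C_def by (rule left_Dg_category)
  interpret C: dg_category K C by (rule catC)
  have GC: "G N \<in> obj C" if "N \<in> obj D" for N
    using mate_obj[OF G[OF that]] that by simp
  have catD: "dg_category K D"
    by (rule dg_category_pullback[OF catC GC mate_Hom[OF G G] mate_cmp[OF G] mate_ident[OF G]])
  have FD: "F M \<in> obj D" if "M \<in> obj C" for M
    using mate_obj[OF F[OF that]] that by simp
  have HomF: "Hom D (F X) (F Y) = Hom C X Y" if "X \<in> obj C" "Y \<in> obj C" for X Y
    by (rule mate_Hom[OF F[OF that(1)] F[OF that(2)]])
  have cmpF: "cmp D (F X) (F Y) (F Z) = cmp C X Y Z" if "X \<in> obj C" for X Y Z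
    by (rule mate_cmp[OF F[OF that]])
  (* Since Hom D (F X) (F Y) equals Hom C X Y, the functor is the identity on morphisms. *)
  have "dg_functor K C D F (\<lambda>X Y f. f)"
  proof (rule dg_functor.intro)
    show "is_linear K (Hom C X Y) (Hom D (F X) (F Y)) (\<lambda>f. f)" if "X \<in> obj C" "Y \<in> obj C" for X Y
    proof -
      interpret H: dg_module K "Hom C X Y" by (rule C.Hom_dg_module[OF that])
      show ?thesis by (simp add: HomF[OF that] H.is_linear_id)
    qed
  qed (simp_all add: FD HomF mate_ident[OF F] cmpF)
  moreover have "full_functor C D F (\<lambda>X Y f. f)" by (simp add: full_functor_def HomF)
  moreover have "faithful_functor C (\<lambda>X Y f. f)" by (simp add: faithful_functor_def)
  moreover have "dense_functor C D F"
    unfolding dense_functor_def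
  proof
    fix N assume N: "N \<in> obj D"
    define M where "M = G N"
    have M: "M \<in> obj C" and MN: "mate_actions K A I e M N" and MF: "mate_actions K A I e M (F M)"
      using N GC G F by (auto simp: M_def)
    have Mleft: "left_dg_module K A M" using M by (simp add: C_def left_Dg_def)
    let ?i = "\<lambda>x\<in>carrier M. x"
    interpret h: hom_family K M M "left_hom K A M M" by (rule left_hom_family[OF Mleft Mleft])
    (* The identity of M is closed, and M, N and F M share their morphism complexes. *)
    have "?i \<in> closed0 C M M"
    proof -
      have i: "?i \<in> left_hom K A M M 0" by (rule left_hom_ident[OF Mleft])
      have "hom_dif M M (left_hom K A M M) ?i = (\<lambda>x\<in>carrier M. \<zero>\<^bsub>M\<^esub>)"
        unfolding h.hom_dif_homogeneous[OF i]
        by (rule restrict_ext) (simp add: h.dif_closed ksign_def h.M.minus_eq h.M.r_neg)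
      then show ?thesis
        using i by (simp add: closed0_def C_def left_Dg_def dg_hom_simps)
    qed
    then have "?i \<in> closed0 D (F M) N" "?i \<in> closed0 D N (F M)"
      by (simp_all add: closed0_def mate_Hom[OF MF MN] mate_Hom[OF MN MF])
    moreover have "cmp D (F M) N (F M) ?i ?i = ident D (F M)" "cmp D N (F M) N ?i ?i = ident D N"
      by (auto simp: mate_cmp[OF MF, of _ _ M M] mate_cmp[OF MN, of _ _ M M] mate_ident[OF MF]
          mate_ident[OF MN] C_def left_Dg_def compose_def)
    ultimately have "dg_isomorphic D (F M) N"
      unfolding dg_isomorphic_def by blast
    then show "\<exists>X\<in>obj C. dg_isomorphic D (F X) N" using M by blast
  qed
  ultimately show ?thesis
    unfolding dg_equivalent_def using catC catD by blast
qed

end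

theorem proposition4p3:
  fixes K :: "('k, 'x) ring_scheme" and A :: "('k, 'a) dgmodule"
    and I :: "'i set" and e :: "'i \<Rightarrow> 'a"
    and A_Dg :: "(('k, 'a, 'm) left_dgmodule, 'k, 'm \<Rightarrow> 'm) dgcat"
    and Dg_Aop :: "(('k, 'a, 'm) right_dgmodule, 'k, 'm \<Rightarrow> 'm) dgcat"
  assumes "dg_algebra_enough_idempotents K A I e"
    and "A_Dg = left_Dg K A"
    and "Dg_Aop = right_Dg K (dg_op A)"
  shows "(\<forall>M\<in>obj A_Dg. \<forall>N\<in>obj A_Dg. \<forall>n. \<forall>f\<in>grade (Hom A_Dg M N) n.
            dif (Hom A_Dg M N) f =
              (\<lambda>x\<in>carrier M. dif N (f x) \<ominus>\<^bsub>N\<^esub> ksign N n (f (dif M x))))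
    \<and> dg_category K A_Dg
    \<and> dg_equivalent K A_Dg Dg_Aop"
proof -
  interpret dg_algebra_enough_idempotents K A I e by fact
  have "dif (Hom A_Dg M N) f = (\<lambda>x\<in>carrier M. dif N (f x) \<ominus>\<^bsub>N\<^esub> ksign N n (f (dif M x)))"
    if "M \<in> obj A_Dg" "N \<in> obj A_Dg" "f \<in> grade (Hom A_Dg M N) n" for M N n f
  proof -
    have "left_dg_module K A M" "left_dg_module K A N" and f: "f \<in> left_hom K A M N n"
      using that by (auto simp: assms(2) left_Dg_def dg_hom_simps)
    then interpret hom_family K M N "left_hom K A M N" by (intro left_hom_family)
    show ?thesis
      using hom_dif_homogeneous[OF f] by (simp add: assms(2) left_Dg_def dg_hom_simps)
  qed
  moreover have "dg_equivalent K A_Dg Dg_Aop"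
    unfolding assms(2,3) by (rule left_right_equivalent)
  ultimately show ?thesis
    by (auto simp: dg_equivalent_def)
qed

end
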